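(* Let $p\geq 2$, $d\geq 2$, and let $u\in W^{1,p}_{A}(\mathbb{R}^d)$. Then $$ \int_{\mathbb{R}^d}|\nabla u(x)|^p\,dx\geq C_H(d,p)\int_{\mathbb{R}^d}\frac{|u(x)|^p}{|x|^p}\,dx, $$ where $$ C_H(d,p)=\left(\frac{2(p-2)d(d-1)}{p^2}+\left(\frac{d^2-p}{p}\right)^2\right)^{\frac{p}{2}}. $$
   Context: A function $u$ on $\mathbb{R}^d$ is called antisymmetric if $u(x_1,\dots,x_i,\dots,x_j,\dots,x_d)=-u(x_1,\dots,x_j,\dots,x_i,\dots,x_d)$ for all $1\leq i\neq j\leq d$ (i.e. it changes sign when any two coordinates are swapped). $W^{k,p}(\mathbb{R}^d)$ is the usual Sobolev space, and $W^{k,p}_{A}(\mathbb{R}^d)=\{u\in W^{k,p}(\mathbb{R}^d): u \text{ is antisymmetric}\}$. $|\cdot|$ denotes the Euclidean norm. *)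

theory Defs
  imports "HOL-Analysis.Analysis"
begin

text \<open>
  The value type is a type variable of class \<open>{real_normed_field, euclidean_space}\<close>: it can be
  instantiated to \<open>real\<close> and to \<open>complex\<close>, so that real-valued and complex-valued functions are
  treated at once. The dimension is \<open>CARD('n)\<close>.
\<close>

definition partial :: "'n \<Rightarrow> (real^'n \<Rightarrow> real) \<Rightarrow> real^'n::finite \<Rightarrow> real" where
  "partial i f = (\<lambda>x. frechet_derivative f (at x) (axis i 1))"

primrec C_k :: "nat \<Rightarrow> (real^'n::finite \<Rightarrow> real) \<Rightarrow> bool" where
  "C_k 0 f \<longleftrightarrow> continuous_on UNIV f"
| "C_k (Suc k) f \<longleftrightarrow> (\<forall>x. f differentiable at x) \<and> (\<forall>i. C_k k (partial i f))"

definition test_functions :: "(real^'n::finite \<Rightarrow> real) set" where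
  "test_functions = {\<phi>. (\<forall>k. C_k k \<phi>) \<and> compact (closure {x. \<phi> x \<noteq> 0})}"

definition locally_integrable :: "(real^'n::finite \<Rightarrow> 'b::euclidean_space) \<Rightarrow> bool" where
  "locally_integrable f \<longleftrightarrow> (\<forall>K. compact K \<longrightarrow> set_integrable lebesgue K f)"

text \<open>
  Testing against real-valued functions suffices also for complex-valued \<open>u\<close>, by linearity.
  Weak gradients are unique only up to null sets, hence a relation. On the type \<open>'b^'n\<close> the norm
  is \<open>sqrt (\<Sum>i. (norm (g x $ i))\<^sup>2)\<close>.
\<close>

definition has_weak_gradient ::
  "(real^'n::finite \<Rightarrow> 'b::{real_normed_field,euclidean_space}) \<Rightarrow> (real^'n \<Rightarrow> 'b^'n) \<Rightarrow> bool"
  (infix "has'_weak'_gradient" 50) where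
  "u has_weak_gradient g \<longleftrightarrow> locally_integrable u \<and> locally_integrable g \<and>
     (\<forall>\<phi>\<in>test_functions. \<forall>i.
        (LINT x|lebesgue. partial i \<phi> x *\<^sub>R u x) = - (LINT x|lebesgue. \<phi> x *\<^sub>R (g x $ i)))"

definition Lp_space :: "real \<Rightarrow> (real^'n::finite \<Rightarrow> 'b::euclidean_space) set" where
  "Lp_space p = {f. f \<in> borel_measurable lebesgue \<and> integrable lebesgue (\<lambda>x. norm (f x) powr p)}"

definition sobolev_W1 ::
  "real \<Rightarrow> (real^'n::finite \<Rightarrow> 'b::{real_normed_field,euclidean_space}) set" where
  "sobolev_W1 p = {u \<in> Lp_space p. \<exists>g \<in> Lp_space p. u has_weak_gradient g}"

definition swap_coords :: "'n \<Rightarrow> 'n \<Rightarrow> real^'n \<Rightarrow> real^'n::finite" where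
  "swap_coords i j x = (\<chi> k. x $ Transposition.transpose i j k)"

text \<open>Elements of Sobolev spaces are classes modulo null sets, so antisymmetry is required
  almost everywhere.\<close>

definition antisymmetric :: "(real^'n::finite \<Rightarrow> 'b::euclidean_space) \<Rightarrow> bool" where
  "antisymmetric u \<longleftrightarrow> (\<forall>i j. i \<noteq> j \<longrightarrow> (AE x in lebesgue. u (swap_coords i j x) = - u x))"

definition sobolev_W1A ::
  "real \<Rightarrow> (real^'n::finite \<Rightarrow> 'b::{real_normed_field,euclidean_space}) set" where
  "sobolev_W1A p = {u \<in> sobolev_W1 p. antisymmetric u}"

definition C_H :: "nat \<Rightarrow> real \<Rightarrow> real" where
  "C_H d p = (2 * (p - 2) * real d * (real d - 1) / p\<^sup>2 + (((real d)\<^sup>2 - p) / p)\<^sup>2) powr (p / 2)"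

end

theory Submission
  imports Defs
begin

text \<open>
  Write \<open>d\<close> for the dimension and \<open>\<ell> = d (d - 1) / 2\<close> for the degree of the Vandermonde product
  \<open>V x = (\<Prod>i<j. x $ i - x $ j)\<close>, the antisymmetric polynomial of lowest degree; it is harmonic. The
  function \<open>\<phi> = \<bar>x\<bar> powr \<alpha> * V\<close>, with \<open>\<alpha>\<close> chosen such that \<open>\<phi>\<close> has degree \<open>(p - d) / 2\<close>, satisfies
  \<open>div (\<bar>x\<bar> powr (2 - p) \<nabla>\<phi>) = - C \<bar>x\<bar> powr (- p) \<phi>\<close> with \<open>C = (d\<^sup>2 - p)\<^sup>2 / 4 + (p - 2) \<ell>\<close>, and
  \<open>C_H d p\<close> is \<open>(4 C / p\<^sup>2) powr (p / 2)\<close>.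

  For a smooth antisymmetric \<open>v\<close> with bounded support, consider the field
  \<open>\<bar>v\<bar>\<^sup>p \<bar>x\<bar> powr (2 - p) \<nabla>\<phi> / \<phi>\<close>. It is singular where \<open>\<phi>\<close> vanishes, but \<open>v\<close> vanishes there too, and
  at least linearly (\<open>norm_le_coord_diff\<close>), so its divergence has integral zero
  (\<open>integral_directional_derivative_zero\<close>). Completing a square in that divergence yields
  \<open>C \<integral> (\<bar>v\<bar> / \<bar>x\<bar>)\<^sup>p \<le> p\<^sup>2 / 4 * \<integral> (\<bar>v\<bar> / \<bar>x\<bar>) powr (p - 2) * \<bar>\<nabla>v\<bar>\<^sup>2\<close> (\<open>integral_weighted_hardy\<close>), and the tangent
  inequality for \<open>t powr (p / 2)\<close> turns this into the claim for \<open>v\<close> (\<open>hardy_smooth\<close>).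

  A general \<open>u\<close> is mollified with a permutation-invariant kernel and multiplied by a radial cutoff,
  which preserves antisymmetry (\<open>mollified_cutoff_smooth_antisymmetric\<close>). In the limit
  (\<open>hardy_weak_gradient\<close>), the side of \<open>u\<close> is controlled by Fatou's lemma and convergence almost
  everywhere (\<open>correlate_cube_kernel_tendsto\<close>), the side of the gradient by Jensen's inequality
  (\<open>nn_integral_correlate_powr_le\<close>).
\<close>

section \<open>Convexity of powers and the derivative of the norm power\<close>

text \<open>
  The tangent inequality serves twice: for the exponent \<open>p / 2\<close> it replaces Hoelder's inequality in
  the smooth case, and for \<open>p\<close> it gives Jensen's inequality for averages.
\<close>

lemma powr_above_tangent:
  fixes p s t :: real
  assumes "p \<ge> 1" "s \<ge> 0" "t \<ge> 0"
  shows "s powr p + p * s powr (p - 1) * (t - s) \<le> t powr p"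
proof (cases "s = 0 \<or> t = 0")
  case True
  then consider "s = 0" | "t = 0" "s > 0" using assms by linarith
  then show ?thesis
  proof cases
    case 2
    have e: "s powr (p - 1) * (t - s) = - (s powr p)" using 2 by (simp add: powr_diff)
    have "s powr p + p * s powr (p - 1) * (t - s) = (1 - p) * s powr p"
      unfolding mult.assoc e by (simp add: algebra_simps)
    also have "\<dots> \<le> 0" using assms by (simp add: mult_le_0_iff)
    also have "0 \<le> t powr p" by simp
    finally show ?thesis .
  qed simp
next
  case False
  then have st: "s > 0" "t > 0" using assms by auto
  have "((\<lambda>x. x powr p) has_real_derivative p * s powr (p - 1)) (at s)"
    using st by (intro has_real_derivative_powr)
  then have "((\<lambda>x. x powr p) has_real_derivative p * s powr (p - 1)) (at s within {0<..})"
    by (rule has_field_derivative_at_within)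
  then have "(\<lambda>x. x powr p) t - (\<lambda>x. x powr p) s \<ge> p * s powr (p - 1) * (t - s)"
    using st by (intro convex_on_imp_above_tangent[OF powr_convex[OF assms(1)]])
      (simp_all add: interior_open is_interval_connected)
  then show ?thesis by simp
qed

text \<open>
  Convexity, applied to \<open>a + b = (1 - l) (a / (1 - l)) + l (b / l)\<close>. As \<open>l \<rightarrow> 0\<close> the constant in front
  of \<open>a\<close> tends to 1, so that a vanishing perturbation \<open>b\<close> costs nothing in the sharp constant.
\<close>

lemma powr_add_le_weighted:
  fixes a b p l :: real
  assumes "p \<ge> 1" "a \<ge> 0" "b \<ge> 0" "0 < l" "l < 1"
  shows "(a + b) powr p \<le> (1 - l) powr (1 - p) * a powr p + l powr (1 - p) * b powr p"
proof -
  define s x y where "s = a + b" and "x = a / (1 - l)" and "y = b / l"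
  have s: "s \<ge> 0" and x: "x \<ge> 0" and y: "y \<ge> 0" using assms by (auto simp: s_def x_def y_def)
  have "(1 - l) * (s powr p + p * s powr (p - 1) * (x - s)) + l * (s powr p + p * s powr (p - 1) * (y - s))
      = s powr p + p * s powr (p - 1) * (((1 - l) * x + l * y) - s)"
    by (simp add: algebra_simps)
  also have "(1 - l) * x + l * y = s" using assms by (simp add: x_def y_def s_def)
  finally have "s powr p = (1 - l) * (s powr p + p * s powr (p - 1) * (x - s)) + l * (s powr p + p * s powr (p - 1) * (y - s))"
    by simp
  also have "\<dots> \<le> (1 - l) * x powr p + l * y powr p"
    using assms powr_above_tangent[OF assms(1) s x] powr_above_tangent[OF assms(1) s y]
    by (intro add_mono mult_left_mono) auto
  also have "\<dots> = (1 - l) powr (1 - p) * a powr p + l powr (1 - p) * b powr p"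
    using assms by (simp add: x_def y_def powr_divide powr_diff)
  finally show ?thesis by (simp add: s_def)
qed

lemma has_derivative_norm_powr:
  fixes w :: "'a::real_inner"
  assumes "p > 1"
  shows "((\<lambda>w. norm w powr p) has_derivative (\<lambda>h. p * norm w powr (p - 2) * (w \<bullet> h))) (at w)"
proof (cases "w = 0")
  case True
  have "((\<lambda>h::'a. norm h powr (p - 1)) \<longlongrightarrow> 0) (at 0)"
  proof -
    have "((\<lambda>h::'a. norm h powr (p - 1)) \<longlongrightarrow> norm (0::'a) powr (p - 1)) (at 0)"
      using assms by (intro tendsto_powr' tendsto_norm tendsto_ident_at tendsto_const) auto
    then show ?thesis by simp
  qed
  moreover have "\<forall>\<^sub>F h::'a in at 0. norm h powr (p - 1) = norm (norm h powr p) / norm h"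
    by (auto simp: eventually_at powr_diff intro!: exI[of _ 1])
  ultimately have "((\<lambda>h::'a. norm (norm h powr p) / norm h) \<longlongrightarrow> 0) (at 0)"
    by (rule Lim_transform_eventually)
  then show ?thesis using True by (simp add: has_derivative_at)
next
  case False
  have n: "(norm has_derivative (\<lambda>h. sgn w \<bullet> h)) (at w)"
    using has_derivative_norm[OF False] by (simp add: inner_commute)
  have "((\<lambda>w. norm w powr p) has_derivative (\<lambda>h. p * norm w powr (p - 1) * (sgn w \<bullet> h))) (at w)"
    using False by (auto intro!: derivative_eq_intros n simp: powr_diff field_simps)
  moreover have "p * norm w powr (p - 1) * (sgn w \<bullet> h) = p * norm w powr (p - 2) * (w \<bullet> h)" for h
    using False by (simp add: sgn_div_norm powr_diff power2_eq_square field_simps)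
  ultimately show ?thesis by simp
qed

section \<open>Integrals of directional derivatives\<close>

lemma lborel_integral_translate:
  fixes f :: "'a::euclidean_space \<Rightarrow> 'b::euclidean_space"
  shows "(LINT x|lborel. f (x + a)) = (LINT x|lborel. f x)"
    and "integrable lborel (\<lambda>x. f (x + a)) \<longleftrightarrow> integrable lborel f"
proof -
  have eq: "distr lborel borel (\<lambda>x. x + a) = (lborel :: 'a measure)"
    using lborel_distr_plus[of a] by (simp add: add.commute[of _ a])
  show 1: "integrable lborel (\<lambda>x. f (x + a)) \<longleftrightarrow> integrable lborel f"
  proof
    assume "integrable lborel f"
    then have "integrable (distr lborel borel (\<lambda>x. x + a)) f" by (simp add: eq)
    then show "integrable lborel (\<lambda>x. f (x + a))" by (rule integrable_distr[rotated]) simp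
  next
    assume i: "integrable lborel (\<lambda>x. f (x + a))"
    have eq': "distr lborel borel (\<lambda>x. x - a) = (lborel :: 'a measure)"
      using lborel_distr_plus[of "-a"] by (metis (no_types, lifting) add.commute diff_conv_add_uminus ext)

    have "integrable (distr lborel borel (\<lambda>x. x - a)) (\<lambda>x. f (x + a))" using i by (simp add: eq')
    then have "integrable lborel (\<lambda>x. f ((x - a) + a))" by (rule integrable_distr[rotated]) simp
    then show "integrable lborel f" by simp
  qed
  show "(LINT x|lborel. f (x + a)) = (LINT x|lborel. f x)"
  proof (cases "f \<in> borel_measurable borel")
    case True
    have "(LINT x|lborel. f x) = (LINT x|distr lborel borel (\<lambda>x. x + a). f x)" by (simp add: eq)
    also have "\<dots> = (LINT x|lborel. f (x + a))" using True by (subst integral_distr) auto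
    finally show ?thesis by simp
  next
    case False
    then have "\<not> integrable lborel f" by (auto dest: borel_measurable_integrable)
    then show ?thesis using 1 by (simp add: not_integrable_integral_eq)
  qed
qed

text \<open>
  This is the divergence theorem in the only form needed: integrate the fundamental theorem of
  calculus along the segment from \<open>x\<close> to \<open>x + e\<close> over all \<open>x\<close>. By translation invariance the
  increments \<open>W (x + e) - W x\<close> integrate to zero, and by Fubini so does the derivative. Working with
  segments avoids splitting off a coordinate, and the finite exceptional set on each line leaves
  room for fields that are singular on hyperplanes.
\<close>

lemma integral_directional_derivative_zero:
  fixes W w :: "'a::euclidean_space \<Rightarrow> real"
  assumes W: "integrable lborel W" and w: "integrable lborel w"
    and line: "AE x in lborel. \<exists>S. finite S \<and> continuous_on UNIV (\<lambda>s. W (x + s *\<^sub>R e)) \<and>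
        (\<forall>s. s \<notin> S \<longrightarrow> ((\<lambda>s. W (x + s *\<^sub>R e)) has_real_derivative w (x + s *\<^sub>R e)) (at s))"
  shows "(LINT x|lborel. w x) = 0"
proof -
  define F where "F = (\<lambda>(s::real, x). indicator {0..1} s * w (x + s *\<^sub>R e))"
  have [measurable]: "w \<in> borel_measurable borel" using w by auto
  have F: "integrable (lborel \<Otimes>\<^sub>M lborel) F"
  proof (rule lborel_pair.Fubini_integrable)
    show "F \<in> borel_measurable (lborel \<Otimes>\<^sub>M lborel)" unfolding F_def by measurable
    have "(LINT x|lborel. norm (F (s, x))) = indicator {0..1} s * (LINT x|lborel. norm (w x))" for s
      using lborel_integral_translate(1)[of "\<lambda>x. norm (w x)" "s *\<^sub>R e"]
      by (simp add: F_def abs_mult)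
    then show "integrable lborel (\<lambda>s. LINT x|lborel. norm (F (s, x)))"
      by simp
    show "AE s in lborel. integrable lborel (\<lambda>x. F (s, x))"
      using lborel_integral_translate(2)[of w] w by (simp add: F_def)
  qed
  have "(LINT s|lborel. (LINT x|lborel. F (s, x))) = (LINT s|lborel. indicator {0..1::real} s * (LINT x|lborel. w x))"
    using lborel_integral_translate(1)[of w] by (simp add: F_def)
  also have "\<dots> = (LINT x|lborel. w x)" by simp
  finally have 1: "(LINT s|lborel. (LINT x|lborel. F (s, x))) = (LINT x|lborel. w x)" .
  have F': "integrable (lborel \<Otimes>\<^sub>M lborel) (\<lambda>(s, x). F (s, x))" using F by simp
  have "(LINT s|lborel. (LINT x|lborel. F (s, x))) = (LINT x|lborel. (LINT s|lborel. F (s, x)))"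
    using lborel_pair.Fubini_integral[OF F'] by simp
  also have "\<dots> = (LINT x|lborel. W (x + e) - W x)"
  proof (rule integral_cong_AE)
    show "(\<lambda>x. LINT s|lborel. F (s, x)) \<in> borel_measurable lborel"
      using lborel_pair.integrable_snd[OF F'] by auto
    show "(\<lambda>x. W (x + e) - W x) \<in> borel_measurable lborel" using W by auto
    have "AE x in lborel. integrable lborel (\<lambda>s. F (s, x))" 
      using lborel_pair.AE_integrable_snd[OF F'] .
    with line show "AE x in lborel. (LINT s|lborel. F (s, x)) = W (x + e) - W x"
    proof eventually_elim
      case (elim x)
      then obtain S where S: "finite S" "continuous_on UNIV (\<lambda>s. W (x + s *\<^sub>R e))"
        "\<And>s. s \<notin> S \<Longrightarrow> ((\<lambda>s. W (x + s *\<^sub>R e)) has_real_derivative w (x + s *\<^sub>R e)) (at s)"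
        by blast
      have "((\<lambda>s. w (x + s *\<^sub>R e)) has_integral (W (x + 1 *\<^sub>R e) - W (x + 0 *\<^sub>R e))) {0..1}"
        using S(3) by (intro fundamental_theorem_of_calculus_interior_strong[OF S(1)])
          (auto simp: has_real_derivative_iff_has_vector_derivative intro: continuous_on_subset[OF S(2)])
      moreover have si: "set_integrable lborel {0..1} (\<lambda>s. w (x + s *\<^sub>R e))"
        using elim(2) by (simp add: set_integrable_def F_def)
      note set_borel_integral_eq_integral[OF si]
      ultimately show ?case
        by (simp add: F_def set_lebesgue_integral_def integral_unique)
    qed
  qed
  also have "\<dots> = 0"
    using W lborel_integral_translate[of W e] by simp
  finally show ?thesis using 1 by simp
qed

section \<open>The ground state built from the Vandermonde product\<close>

text \<open>
  Euler's identity for the Vandermonde product, which is homogeneous of degree \<open>d (d - 1) / 2\<close>.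
  The diagonal terms vanish since \<open>1 / 0 = 0\<close>.
\<close>

lemma sum_x_recip_diff:
  fixes x :: "real^'n::finite"
  assumes "\<And>i j. i \<noteq> j \<Longrightarrow> x $ i \<noteq> x $ j"
  shows "(\<Sum>i\<in>UNIV. x $ i * (\<Sum>j\<in>UNIV. 1 / (x $ i - x $ j))) = real CARD('n) * (real CARD('n) - 1) / 2"
proof -
  define A where "A = (\<Sum>i\<in>UNIV. \<Sum>j\<in>UNIV. x $ i / (x $ i - x $ j))"
  have "A = (\<Sum>i\<in>UNIV. \<Sum>j\<in>UNIV. x $ j / (x $ j - x $ i))"
    unfolding A_def by (rule sum.swap)
  then have "2 * A = (\<Sum>i\<in>UNIV. \<Sum>j\<in>UNIV. x $ i / (x $ i - x $ j) + x $ j / (x $ j - x $ i))"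
    unfolding A_def by (simp add: sum.distrib)
  also have "\<dots> = (\<Sum>i\<in>(UNIV::'n set). \<Sum>j\<in>UNIV. 1 - (if i = j then 1 else 0))"
  proof (intro sum.cong refl)
    fix i j :: 'n
    show "x $ i / (x $ i - x $ j) + x $ j / (x $ j - x $ i) = 1 - (if i = j then 1 else 0)"
    proof (cases "i = j")
      case False
      then have "x $ i - x $ j \<noteq> 0" "x $ j - x $ i \<noteq> 0" using assms[of i j] by auto
      then have "x $ i / (x $ i - x $ j) + x $ j / (x $ j - x $ i) = (x $ i - x $ j) / (x $ i - x $ j)"
        by (simp add: divide_simps) (simp add: algebra_simps)
      then show ?thesis using False assms[of i j] by simp
    qed simp
  qed
  also have "\<dots> = real CARD('n) * (real CARD('n) - 1)"
    by (simp add: sum_subtractf algebra_simps)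
  finally have "A = real CARD('n) * (real CARD('n) - 1) / 2" by simp
  then show ?thesis by (simp add: A_def sum_distrib_left)
qed

text \<open>
  This is the harmonicity of the Vandermonde product, written for its logarithmic gradient. The
  products with three distinct indices cancel in cyclic triples, because
  \<open>1 / ((a - b) (a - c)) + 1 / ((b - c) (b - a)) + 1 / ((c - a) (c - b)) = 0\<close>.
\<close>

lemma sum_square_recip_diff:
  fixes x :: "real^'n::finite"
  assumes "\<And>i j. i \<noteq> j \<Longrightarrow> x $ i \<noteq> x $ j"
  shows "(\<Sum>i\<in>UNIV. (\<Sum>j\<in>UNIV. 1 / (x $ i - x $ j))\<^sup>2) = (\<Sum>i\<in>UNIV. \<Sum>j\<in>UNIV. 1 / (x $ i - x $ j)\<^sup>2)"
proof -
  define t where "t i j = 1 / (x $ i - x $ j)" for i j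
  define f where "f i j k = t i j * t i k" for i j k
  define e where "e i j k = (if j = k then (t i j)\<^sup>2 else 0)" for i j k
  have cyc: "f i j k + f j k i + f k i j = e i j k + e j k i + e k i j" for i j k
  proof (cases "i \<noteq> j \<and> j \<noteq> k \<and> i \<noteq> k")
    case True
    then have "x $ i - x $ j \<noteq> 0" "x $ j - x $ k \<noteq> 0" "x $ i - x $ k \<noteq> 0"
       "x $ j - x $ i \<noteq> 0" "x $ k - x $ j \<noteq> 0" "x $ k - x $ i \<noteq> 0"
      using assms[of i j] assms[of j k] assms[of i k] by auto
    then have "f i j k + f j k i + f k i j = 0"
      unfolding f_def t_def by (simp add: divide_simps) (simp add: algebra_simps)
    then show ?thesis using True by (auto simp: e_def)
  next
    case False
    have "t i i = 0" "(t i j)\<^sup>2 = (t j i)\<^sup>2" for i j by (auto simp: t_def power2_commute power_divide)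
    then show ?thesis using False
      by (auto simp: f_def e_def power2_eq_square)
  qed
  have rot: "(\<Sum>i\<in>UNIV. \<Sum>j\<in>UNIV. \<Sum>k\<in>UNIV. h j k i) = (\<Sum>i\<in>UNIV. \<Sum>j\<in>UNIV. \<Sum>k\<in>UNIV. h i j k)"
    for h :: "'n \<Rightarrow> 'n \<Rightarrow> 'n \<Rightarrow> real"
  proof -
    have "(\<Sum>i\<in>UNIV. \<Sum>j\<in>UNIV. \<Sum>k\<in>UNIV. h j k i) = (\<Sum>j\<in>UNIV. \<Sum>i\<in>UNIV. \<Sum>k\<in>UNIV. h j k i)"
      by (rule sum.swap)
    also have "\<dots> = (\<Sum>j\<in>UNIV. \<Sum>k\<in>UNIV. \<Sum>i\<in>UNIV. h j k i)"
      by (intro sum.cong refl sum.swap)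
    finally show ?thesis .
  qed
  have three: "(\<Sum>i\<in>UNIV. \<Sum>j\<in>UNIV. \<Sum>k\<in>UNIV. h i j k + h j k i + h k i j) =
      3 * (\<Sum>i\<in>UNIV. \<Sum>j\<in>UNIV. \<Sum>k\<in>UNIV. h i j k)" for h :: "'n \<Rightarrow> 'n \<Rightarrow> 'n \<Rightarrow> real"
    using rot[of h] rot[of "\<lambda>i j k. h j k i"] by (simp add: sum.distrib)
  have "(\<Sum>i\<in>UNIV. \<Sum>j\<in>UNIV. \<Sum>k\<in>UNIV. f i j k) = (\<Sum>i\<in>UNIV. \<Sum>j\<in>UNIV. \<Sum>k\<in>UNIV. e i j k)"
    using three[of f] three[of e] by (simp add: cyc)
  then show ?thesis
    by (simp add: f_def e_def t_def power2_eq_square sum_product)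
qed

lemma norm_axis_line_squared:
  fixes x :: "real^'n::finite"
  shows "(norm (x + s *\<^sub>R axis i 1))\<^sup>2 = (norm x)\<^sup>2 + 2 * s * x $ i + s\<^sup>2"
proof -
  have "(x + s *\<^sub>R axis i 1) \<bullet> (x + s *\<^sub>R axis i 1) = x \<bullet> x + 2 * s * x $ i + s\<^sup>2"
    by (simp only: inner_add_left inner_add_right inner_scaleR_left inner_scaleR_right inner_axis inner_axis'
        inner_real_def) (simp add: power2_eq_square axis_def algebra_simps)
  then show ?thesis by (simp only: power2_norm_eq_inner)
qed

text \<open>
  The logarithmic gradient of the ground state \<open>\<bar>x\<bar> powr \<alpha> * (\<Prod>i<j. x $ i - x $ j)\<close>. As the index type
  carries no order, the product is determined only up to sign, but this does not affect the logarithmic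
  gradient. The term \<open>j = i\<close> is zero.
\<close>

definition ground_log_grad :: "real \<Rightarrow> real^'n \<Rightarrow> 'n::finite \<Rightarrow> real" where
  "ground_log_grad \<alpha> x i = (\<Sum>j\<in>UNIV. 1 / (x $ i - x $ j)) + \<alpha> * x $ i / (norm x)\<^sup>2"

text \<open>
  The partial derivative of the \<open>i\<close>-th component in direction \<open>i\<close>, off the hyperplanes \<open>x $ i = x $ j\<close>.
\<close>

definition ground_log_grad_deriv :: "real \<Rightarrow> real^'n \<Rightarrow> 'n::finite \<Rightarrow> real" where
  "ground_log_grad_deriv \<alpha> x i = - (\<Sum>j\<in>UNIV. 1 / (x $ i - x $ j)\<^sup>2) + \<alpha> * (1 / (norm x)\<^sup>2 - 2 * (x $ i)\<^sup>2 / (norm x)^4)"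

lemma weighted_ground_log_grad_has_derivative:
  fixes x :: "real^'n::finite"
  assumes "x \<noteq> 0" "\<And>j. j \<noteq> i \<Longrightarrow> x $ i \<noteq> x $ j"
  shows "((\<lambda>s. norm (x + s *\<^sub>R axis i 1) powr (2 - p) * ground_log_grad \<alpha> (x + s *\<^sub>R axis i 1) i) has_real_derivative
      norm x powr (2 - p) * ((2 - p) * x $ i / (norm x)\<^sup>2 * ground_log_grad \<alpha> x i + ground_log_grad_deriv \<alpha> x i)) (at 0)"
proof -
  let ?y = "\<lambda>s::real. x + s *\<^sub>R axis i 1"
  have y_i: "?y s $ i = x $ i + s" for s by simp
  have y_j: "?y s $ j = x $ j" if "j \<noteq> i" for s j using that by (simp add: axis_def)
  have n0: "(norm x)\<^sup>2 \<noteq> 0" using assms by simp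
  have n2: "((\<lambda>s. (norm (?y s))\<^sup>2) has_real_derivative 2 * x $ i) (at 0)"
  proof -
    have "(norm (?y s))\<^sup>2 = (norm x)\<^sup>2 + 2 * s * x $ i + s\<^sup>2" for s
      by (rule norm_axis_line_squared)
    then show ?thesis by (auto intro!: derivative_eq_intros)
  qed
  have np: "((\<lambda>s. norm (?y s) powr (2 - p)) has_real_derivative norm x powr (2 - p) * ((2 - p) * x $ i / (norm x)\<^sup>2)) (at 0)"
  proof -
    have e: "norm z powr (2 - p) = ((norm z)\<^sup>2) powr ((2 - p) / 2)" for z :: "real^'n"
      by (cases "z = 0") (simp_all add: powr_powr diff_divide_distrib flip: powr_numeral)
    have "((\<lambda>s. ((norm (?y s))\<^sup>2) powr ((2 - p) / 2)) has_real_derivative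
       ((2 - p) / 2) * ((norm x)\<^sup>2) powr ((2 - p) / 2 - 1) * (2 * x $ i)) (at 0)"
      using DERIV_fun_powr[OF n2, of "(2 - p) / 2"] n0 by simp
    moreover have "((2 - p) / 2) * ((norm x)\<^sup>2) powr ((2 - p) / 2 - 1) * (2 * x $ i)
        = norm x powr (2 - p) * ((2 - p) * x $ i / (norm x)\<^sup>2)"
    proof -
      have "((norm x)\<^sup>2) powr ((2 - p) / 2 - 1) = norm x powr (2 - p) / (norm x)\<^sup>2"
        unfolding e by (subst powr_diff) simp
      then show ?thesis by (simp only:) simp
    qed
    ultimately show ?thesis by (simp add: e)
  qed
  have t: "((\<lambda>s. 1 / (?y s $ i - ?y s $ j)) has_real_derivative - (1 / (x $ i - x $ j)\<^sup>2)) (at 0)" for j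
  proof (cases "j = i")
    case False
    have "((\<lambda>s. 1 / (x $ i + s - x $ j)) has_real_derivative - (1 / (x $ i - x $ j)\<^sup>2)) (at 0)"
      using assms(2)[OF False] by (auto intro!: derivative_eq_intros simp: power2_eq_square)
    then show ?thesis using False by (simp add: axis_def)
  qed simp
  have q: "((\<lambda>s. \<alpha> * ?y s $ i / (norm (?y s))\<^sup>2) has_real_derivative
      \<alpha> * (1 / (norm x)\<^sup>2 - 2 * (x $ i)\<^sup>2 / (norm x)^4)) (at 0)"
  proof -
    have "((\<lambda>s. \<alpha> * (x $ i + s) / (norm (?y s))\<^sup>2) has_real_derivative
      (\<alpha> * (norm x)\<^sup>2 - \<alpha> * x $ i * (2 * x $ i)) / ((norm x)\<^sup>2 * (norm x)\<^sup>2)) (at 0)"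
    proof -
      have "((\<lambda>s. \<alpha> * (x $ i + s)) has_real_derivative \<alpha>) (at 0)" by (auto intro!: derivative_eq_intros)
      from DERIV_divide[OF this n2] n0 show ?thesis by simp
    qed
    moreover have "(\<alpha> * (norm x)\<^sup>2 - \<alpha> * x $ i * (2 * x $ i)) / ((norm x)\<^sup>2 * (norm x)\<^sup>2)
      = \<alpha> * (1 / (norm x)\<^sup>2 - 2 * (x $ i)\<^sup>2 / (norm x)^4)"
      using assms(1) by (simp add: field_simps power2_eq_square power4_eq_xxxx)
    ultimately show ?thesis by simp
  qed
  have "((\<lambda>s. ground_log_grad \<alpha> (?y s) i) has_real_derivative ground_log_grad_deriv \<alpha> x i) (at 0)"
    unfolding ground_log_grad_def ground_log_grad_deriv_def sum_negf[symmetric]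
    by (rule DERIV_add DERIV_sum t q)+
  from DERIV_mult[OF np this] show ?thesis by (rule DERIV_cong) (simp add: algebra_simps)
qed

text \<open>
  This is the equation \<open>div (\<bar>x\<bar> powr (2 - p) \<nabla>\<phi>) = - C \<bar>x\<bar> powr (- p) \<phi>\<close> for the ground state \<open>\<phi>\<close>, divided by
  \<open>\<bar>x\<bar> powr (2 - p) \<phi>\<close>. The value of \<open>\<alpha>\<close> makes \<open>\<phi>\<close> homogeneous of degree \<open>(p - d) / 2\<close>; this is the
  choice that maximises the constant \<open>C\<close>, a concave quadratic in \<open>\<alpha>\<close>.
\<close>

lemma sum_ground_log_grad_identity:
  fixes x :: "real^'n::finite"
  assumes "\<And>i j. i \<noteq> j \<Longrightarrow> x $ i \<noteq> x $ j" "x \<noteq> 0"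
  defines "d \<equiv> real CARD('n)"
  assumes \<alpha>: "\<alpha> = (p - d\<^sup>2) / 2"
  shows "(\<Sum>i\<in>UNIV. (2 - p) * x $ i / (norm x)\<^sup>2 * ground_log_grad \<alpha> x i + ground_log_grad_deriv \<alpha> x i + (ground_log_grad \<alpha> x i)\<^sup>2)
     = - ((d\<^sup>2 - p)\<^sup>2 / 4 + (p - 2) * d * (d - 1) / 2) / (norm x)\<^sup>2"
proof -
  define T where "T i = (\<Sum>j\<in>UNIV. 1 / (x $ i - x $ j))" for i
  define Q where "Q = (\<Sum>i\<in>UNIV. \<Sum>j\<in>UNIV. 1 / (x $ i - x $ j)\<^sup>2)"
  define N where "N = (norm x)\<^sup>2"
  have N: "N \<noteq> 0" "(norm x)^4 = N * N" using assms by (auto simp: N_def power4_eq_xxxx power2_eq_square)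
  have s1: "(\<Sum>i\<in>UNIV. x $ i * T i) = d * (d - 1) / 2"
    using sum_x_recip_diff[OF assms(1)] by (simp add: T_def d_def)
  have s2: "(\<Sum>i\<in>UNIV. (T i)\<^sup>2) = Q"
    using sum_square_recip_diff[OF assms(1)] by (simp add: T_def Q_def)
  have s3: "(\<Sum>i\<in>UNIV. (x $ i)\<^sup>2) = N"
    by (simp add: N_def norm_vec_def L2_set_def sum_nonneg)
  define k1 k2 where "k1 = (2 - p + 2 * \<alpha>) / N" and "k2 = ((2 - p) * \<alpha> - 2 * \<alpha> + \<alpha>\<^sup>2) / N\<^sup>2"
  have "(2 - p) * x $ i / (norm x)\<^sup>2 * ground_log_grad \<alpha> x i + ground_log_grad_deriv \<alpha> x i + (ground_log_grad \<alpha> x i)\<^sup>2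
      = k1 * (x $ i * T i) + k2 * (x $ i)\<^sup>2 + (T i)\<^sup>2 - (\<Sum>j\<in>UNIV. 1 / (x $ i - x $ j)\<^sup>2) + \<alpha> / N" for i
    unfolding ground_log_grad_def ground_log_grad_deriv_def T_def[symmetric] N_def[symmetric] N(2) k1_def k2_def
    using N(1) by (simp add: field_simps power2_eq_square)
  then have "(\<Sum>i\<in>UNIV. (2 - p) * x $ i / (norm x)\<^sup>2 * ground_log_grad \<alpha> x i + ground_log_grad_deriv \<alpha> x i + (ground_log_grad \<alpha> x i)\<^sup>2)
     = (\<Sum>i\<in>UNIV. k1 * (x $ i * T i) + k2 * (x $ i)\<^sup>2 + (T i)\<^sup>2 - (\<Sum>j\<in>UNIV. 1 / (x $ i - x $ j)\<^sup>2) + \<alpha> / N)"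
    by (simp only:)
  also have "\<dots> = k1 * (\<Sum>i\<in>UNIV. x $ i * T i) + k2 * (\<Sum>i\<in>UNIV. (x $ i)\<^sup>2)
       + (\<Sum>i\<in>UNIV. (T i)\<^sup>2) - Q + d * (\<alpha> / N)"
    unfolding sum.distrib sum_subtractf sum_distrib_left Q_def d_def by simp
  also have "\<dots> = k1 * (d * (d - 1) / 2) + k2 * N + d * (\<alpha> / N)"
    unfolding s1 s2 s3 by simp
  also have "\<dots> = ((2 - p + 2 * \<alpha>) * (d * (d - 1) / 2) + (2 - p) * \<alpha> - 2 * \<alpha> + \<alpha>\<^sup>2 + d * \<alpha>) / N"
    using N(1) unfolding k1_def k2_def by (simp add: field_simps power2_eq_square)
  also have "(2 - p + 2 * \<alpha>) * (d * (d - 1) / 2) + (2 - p) * \<alpha> - 2 * \<alpha> + \<alpha>\<^sup>2 + d * \<alpha>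
     = - ((d\<^sup>2 - p)\<^sup>2 / 4 + (p - 2) * d * (d - 1) / 2)"
    unfolding \<alpha> by (simp add: field_simps power2_eq_square)
  finally show ?thesis by (simp add: N_def)
qed

text \<open>
  The difference of the two sides is a multiple of the square \<open>(p / 2 * b - a * S)\<^sup>2\<close>.
\<close>

lemma weighted_young:
  fixes a b r p S :: real
  assumes "a \<ge> 0" "b \<ge> 0" "r > 0" "p \<ge> 2"
  shows "p * a powr (p - 1) * b * (r powr (2 - p) * S)
     \<le> p\<^sup>2 / 4 * ((a / r) powr (p - 2) * b\<^sup>2) + a powr p * r powr (2 - p) * S\<^sup>2"
proof (cases "a = 0")
  case False
  then have a: "a > 0" using assms by simp
  define c where "c = a powr (p - 2) * r powr (2 - p)"
  have c: "c \<ge> 0" by (simp add: c_def)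
  have 1: "a powr (p - 1) * r powr (2 - p) = c * a" "a powr p * r powr (2 - p) = c * a\<^sup>2"
    using a by (auto simp: c_def powr_diff power2_eq_square field_simps)
  have 2: "(a / r) powr (p - 2) = c"
    using a assms by (simp add: c_def powr_divide powr_diff field_simps)
  have "0 \<le> c * (p / 2 * b - a * S)\<^sup>2" using c by simp
  also have "\<dots> = p\<^sup>2 / 4 * (c * b\<^sup>2) + c * a\<^sup>2 * S\<^sup>2 - p * (c * a) * b * S"
    by (simp add: power2_eq_square algebra_simps)
  finally have "p * (c * a) * b * S \<le> p\<^sup>2 / 4 * (c * b\<^sup>2) + c * a\<^sup>2 * S\<^sup>2" by simp
  then show ?thesis unfolding 1(2) 2 1(1)[symmetric] by (simp add: mult_ac)
qed simp

lemma C_H_eq: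
  assumes "p \<ge> 2"
  shows "C_H d p = (4 / p\<^sup>2 * (((real d)\<^sup>2 - p)\<^sup>2 / 4 + (p - 2) * real d * (real d - 1) / 2)) powr (p / 2)"
proof -
  have "2 * (p - 2) * real d * (real d - 1) / p\<^sup>2 + (((real d)\<^sup>2 - p) / p)\<^sup>2
    = 4 / p\<^sup>2 * (((real d)\<^sup>2 - p)\<^sup>2 / 4 + (p - 2) * real d * (real d - 1) / 2)"
    using assms by (simp add: power_divide divide_simps) (simp add: algebra_simps)
  then show ?thesis by (simp add: C_H_def)
qed

section \<open>Smooth antisymmetric functions\<close>

lemma bounded_if_zero_outside_ball:
  fixes h :: "'a::euclidean_space \<Rightarrow> 'c::real_normed_vector"
  assumes "continuous_on UNIV h" "\<And>x. norm x > R \<Longrightarrow> h x = 0"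
  obtains M where "M > 0" "\<And>x. norm (h x) \<le> M"
proof -
  have "bounded (h ` cball 0 R)"
    by (intro compact_imp_bounded compact_continuous_image continuous_on_subset[OF assms(1)]) auto
  then obtain M where M: "M > 0" "\<And>x. norm x \<le> R \<Longrightarrow> norm (h x) \<le> M"
    by (auto simp: bounded_pos)
  have "norm (h x) \<le> M" for x
    using M assms(2)[of x] by (cases "norm x \<le> R") auto
  with M(1) show thesis using that by blast
qed

text \<open>
  The class of functions for which the vector-field argument is carried out; \<open>g\<close> is the classical
  gradient of \<open>v\<close>, and antisymmetry holds at every point.
\<close>

locale smooth_antisymmetric =
  fixes v :: "real^'n::finite \<Rightarrow> 'b::euclidean_space" and g :: "real^'n \<Rightarrow> 'b^'n" and R :: real
  assumes dim: "CARD('n) \<ge> 2"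
    and v_cont: "continuous_on UNIV v"
    and g_cont: "continuous_on UNIV g"
    and partials: "\<And>x i. ((\<lambda>s. v (x + s *\<^sub>R axis i 1)) has_vector_derivative g x $ i) (at 0)"
    and v_support: "\<And>x. norm x \<ge> R \<Longrightarrow> v x = 0"
    and g_support: "\<And>x. norm x \<ge> R \<Longrightarrow> g x = 0"
    and antisym: "\<And>x i j. i \<noteq> j \<Longrightarrow> v (swap_coords i j x) = - v x"
begin

lemma other_index: "\<exists>j. j \<noteq> (i::'n)"
proof (rule ccontr)
  assume "\<not> ?thesis"
  then have "(UNIV :: 'n set) = {i}" by auto
  then have "CARD('n) = card {i}" by simp
  then show False using dim by simp
qed

lemma partials_at:
  "((\<lambda>s. v (x + s *\<^sub>R axis i 1)) has_vector_derivative g (x + t *\<^sub>R axis i 1) $ i) (at t)"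
proof -
  have "((\<lambda>s. v ((x + t *\<^sub>R axis i 1) + s *\<^sub>R axis i 1)) \<circ> (\<lambda>s. s - t) has_vector_derivative
      1 *\<^sub>R (g (x + t *\<^sub>R axis i 1) $ i)) (at t)"
    by (rule vector_diff_chain_at) (use partials in \<open>auto intro!: derivative_eq_intros\<close>)
  then show ?thesis by (simp add: o_def algebra_simps)
qed

text \<open>
  An antisymmetric function vanishes on the hyperplanes \<open>x $ i = x $ j\<close>, and being Lipschitz it does
  so linearly: exchanging two coordinates is a path of two axis-parallel segments of length
  \<open>\<bar>x $ i - x $ j\<bar>\<close>, at the end of which \<open>v\<close> has changed by \<open>- 2 v x\<close>. These bounds control all
  singularities below.
\<close>

lemma norm_le_coord_diff:
  obtains C where "C > 0" "\<And>x i j. i \<noteq> j \<Longrightarrow> norm (v x) \<le> C * \<bar>x $ i - x $ j\<bar>"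
    "\<And>x. norm (v x) \<le> C * norm x"
proof -
  obtain M where M: "M > 0" "\<And>x. norm (g x) \<le> M"
    using bounded_if_zero_outside_ball[OF g_cont g_support[OF less_imp_le]] by metis
  have step: "norm (v (x + t *\<^sub>R axis i 1) - v x) \<le> M * \<bar>t\<bar>" for x i t
  proof -
    have "norm ((\<lambda>s. v (x + s *\<^sub>R axis i 1)) t - (\<lambda>s. v (x + s *\<^sub>R axis i 1)) 0) \<le> M * norm (t - 0)"
    proof (rule differentiable_bound)
      show "convex (UNIV :: real set)" by simp
      fix s :: real
      show "((\<lambda>s. v (x + s *\<^sub>R axis i 1)) has_derivative (\<lambda>h. h *\<^sub>R (g (x + s *\<^sub>R axis i 1) $ i))) (at s within UNIV)"
        using partials_at[of x i s] by (simp add: has_vector_derivative_def)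
      show "onorm (\<lambda>h. h *\<^sub>R (g (x + s *\<^sub>R axis i 1) $ i)) \<le> M"
        using M(2)[of "x + s *\<^sub>R axis i 1"] Finite_Cartesian_Product.norm_nth_le[of "g (x + s *\<^sub>R axis i 1)" i]
        by (intro onorm_le) (auto simp: mult.commute[of M] intro!: mult_left_mono)
    qed auto
    then show ?thesis by simp
  qed
  have 1: "norm (v x) \<le> M * \<bar>x $ i - x $ j\<bar>" if "i \<noteq> j" for x i j
  proof -
    define t where "t = x $ j - x $ i"
    have "swap_coords i j x = (x + t *\<^sub>R axis i 1) + (- t) *\<^sub>R axis j 1"
      using that by (auto simp: vec_eq_iff swap_coords_def t_def Transposition.transpose_def axis_def)
    then have "- 2 *\<^sub>R v x = (v ((x + t *\<^sub>R axis i 1) + (- t) *\<^sub>R axis j 1) - v (x + t *\<^sub>R axis i 1))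
        + (v (x + t *\<^sub>R axis i 1) - v x)"
      using antisym[OF that, of x] by (simp add: scaleR_2)
    then have "norm (- 2 *\<^sub>R v x) \<le> M * \<bar>- t\<bar> + M * \<bar>t\<bar>"
      using step by (metis norm_triangle_mono)
    then show ?thesis by (simp add: t_def abs_minus_commute)
  qed
  obtain i j :: 'n where ij: "i \<noteq> j"
    using other_index by metis
  have 2: "norm (v x) \<le> (2 * M) * norm x" for x
  proof -
    have "\<bar>x $ i - x $ j\<bar> \<le> norm x + norm x"
      using component_le_norm_cart[of x i] component_le_norm_cart[of x j] by linarith
    then have "M * \<bar>x $ i - x $ j\<bar> \<le> M * (norm x + norm x)" using M(1) by (intro mult_left_mono) auto
    then show ?thesis using 1[OF ij, of x] by (simp add: algebra_simps)
  qed
  have "norm (v x) \<le> (2 * M) * \<bar>x $ i - x $ j\<bar>" if "i \<noteq> j" for x i j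
  proof -
    have "0 \<le> M * \<bar>x $ i - x $ j\<bar>" using M(1) by simp
    then show ?thesis using 1[OF that, of x] unfolding mult.assoc by linarith
  qed
  with 2 M(1) that[of "2 * M"] show thesis by auto
qed

lemma integrable_if_supported:
  fixes h :: "real^'n \<Rightarrow> real"
  assumes "h \<in> borel_measurable borel" "\<And>x. norm x \<ge> R \<Longrightarrow> h x = 0" "\<And>x. \<bar>h x\<bar> \<le> B"
  shows "integrable lborel h"
proof (rule Bochner_Integration.integrable_bound[where f="\<lambda>x. B * indicator (cball 0 R) x"])
  show "integrable lborel (\<lambda>x. B * indicat_real (cball 0 R) (x::real^'n))"
    using emeasure_bounded_finite[of "cball (0::real^'n) R"]
    by (intro integrable_mult_right integrable_real_indicator) auto
  show "AE x in lborel. norm (h x) \<le> norm (B * indicat_real (cball 0 R) x)"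
  proof (rule AE_I2)
    fix x
    show "norm (h x) \<le> norm (B * indicat_real (cball 0 R) x)"
      using assms(2)[of x] assms(3)[of x] by (cases "norm x \<le> R") auto
  qed
qed (use assms(1) in simp)

lemma borel_v [measurable]: "v \<in> borel_measurable borel"
  using v_cont by (rule borel_measurable_continuous_onI)

lemma borel_g [measurable]: "(\<lambda>x. g x $ i) \<in> borel_measurable borel"
  by (intro borel_measurable_continuous_onI continuous_intros g_cont)

text \<open>
  Here \<open>w\<close> is the \<open>i\<close>-th partial derivative of \<open>\<bar>v\<bar>\<^sup>p m\<close>, where \<open>m\<close> may blow up on the hyperplanes
  \<open>x $ i = x $ j\<close>. Since \<open>\<bar>v\<bar>\<^sup>p \<bar>m\<bar> \<le> B \<bar>v\<bar>\<close>, the product is continuous along lines even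
  at the singular points, because \<open>v\<close> vanishes there; each line in
  direction \<open>i\<close> contains only finitely many of them.
\<close>

lemma integral_partial_multiplier:
  fixes m m' :: "real^'n \<Rightarrow> real" and p :: real
  assumes p: "p \<ge> 2"
    and [measurable]: "m \<in> borel_measurable borel" "m' \<in> borel_measurable borel"
    and deriv: "\<And>x. x \<noteq> 0 \<Longrightarrow> (\<And>j. j \<noteq> i \<Longrightarrow> x $ i \<noteq> x $ j) \<Longrightarrow>
        ((\<lambda>s. m (x + s *\<^sub>R axis i 1)) has_real_derivative m' x) (at 0)"
    and B: "\<And>x. norm (v x) powr (p - 1) * \<bar>m x\<bar> \<le> B"
    and B': "\<And>x. norm (v x) powr p * \<bar>m' x\<bar> \<le> B"
  defines "w \<equiv> \<lambda>x. p * norm (v x) powr (p - 2) * (v x \<bullet> g x $ i) * m x + norm (v x) powr p * m' x"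
  shows "integrable lborel w" "(LINT x|lborel. w x) = 0"
proof -
  obtain Mv where Mv: "Mv > 0" "\<And>x. norm (v x) \<le> Mv"
    using bounded_if_zero_outside_ball[OF v_cont v_support[OF less_imp_le]] by metis
  obtain Mg where Mg: "Mg > 0" "\<And>x. norm (g x) \<le> Mg"
    using bounded_if_zero_outside_ball[OF g_cont g_support[OF less_imp_le]] by metis
  obtain C where C: "\<And>x i j. i \<noteq> j \<Longrightarrow> norm (v x) \<le> C * \<bar>x $ i - x $ j\<bar>" "\<And>x. norm (v x) \<le> C * norm x"
    using norm_le_coord_diff by metis
  have B0: "B \<ge> 0" using order_trans[OF _ B[of 0]] by simp
  define W where "W = (\<lambda>x. norm (v x) powr p * m x)"
  have W_le: "\<bar>W x\<bar> \<le> norm (v x) * B" for x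
  proof -
    have "\<bar>W x\<bar> = norm (v x) * (norm (v x) powr (p - 1) * \<bar>m x\<bar>)"
      by (simp add: W_def abs_mult powr_mult_base flip: mult.assoc)
    also have "\<dots> \<le> norm (v x) * B" using B by (intro mult_left_mono) auto
    finally show ?thesis .
  qed
  show w: "integrable lborel w"
  proof (rule integrable_if_supported)
    show "w \<in> borel_measurable borel" unfolding w_def by measurable
    show "w x = 0" if "norm x \<ge> R" for x using v_support[OF that] by (simp add: w_def)
    fix x
    have "\<bar>p * norm (v x) powr (p - 2) * (v x \<bullet> g x $ i) * m x\<bar>
        \<le> p * norm (v x) powr (p - 2) * (norm (v x) * Mg) * \<bar>m x\<bar>"
    proof -
      have "\<bar>v x \<bullet> g x $ i\<bar> \<le> norm (v x) * Mg"
        using Cauchy_Schwarz_ineq2[of "v x" "g x $ i"] Mg(2)[of x] Finite_Cartesian_Product.norm_nth_le[of "g x" i]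
        by (meson mult_left_mono norm_ge_zero order_trans)
      then show ?thesis using p unfolding abs_mult
        by (intro mult_right_mono mult_mono) auto
    qed
    also have "\<dots> = p * Mg * (norm (v x) powr (p - 1) * \<bar>m x\<bar>)"
    proof -
      have "norm (v x) powr (p - 1) = norm (v x) powr (p - 2) * norm (v x)"
        using powr_mult_base[of "norm (v x)" "p - 2"] by (simp add: mult.commute)
      then show ?thesis by (simp only: mult_ac)
    qed
    also have "\<dots> \<le> p * Mg * B" using B p Mg(1) by (intro mult_left_mono) auto
    finally show "\<bar>w x\<bar> \<le> p * Mg * B + B"
      unfolding w_def using B'[of x] abs_mult[of "norm (v x) powr p" "m' x"]
      by (intro order_trans[OF abs_triangle_ineq] add_mono) auto
  qed
  show "(LINT x|lborel. w x) = 0"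
  proof (rule integral_directional_derivative_zero[where W=W and e="axis i 1"])
    show "integrable lborel w" by fact
    show "integrable lborel W"
    proof (rule integrable_if_supported[where B="Mv * B"])
      show "W \<in> borel_measurable borel" unfolding W_def by measurable
      show "W x = 0" if "norm x \<ge> R" for x using v_support[OF that] by (simp add: W_def)
      show "\<bar>W x\<bar> \<le> Mv * B" for x
        using W_le[of x] Mv(2)[of x] B0 by (meson mult_right_mono order_trans)
    qed
    show "AE x in lborel. \<exists>S. finite S \<and> continuous_on UNIV (\<lambda>s. W (x + s *\<^sub>R axis i 1)) \<and>
        (\<forall>s. s \<notin> S \<longrightarrow> ((\<lambda>s. W (x + s *\<^sub>R axis i 1)) has_real_derivative w (x + s *\<^sub>R axis i 1)) (at s))"
    proof (intro AE_I2 exI conjI allI impI)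
      fix x :: "real^'n"
      let ?y = "\<lambda>s. x + s *\<^sub>R axis i (1::real)"
      define S where "S = (\<lambda>j. x $ j - x $ i) ` (UNIV - {i})"
      show "finite S" by (simp add: S_def)
      have off: "j \<noteq> i \<Longrightarrow> ?y s $ i \<noteq> ?y s $ j" if "s \<notin> S" for s j
      proof
        assume "j \<noteq> i" "?y s $ i = ?y s $ j"
        then have "s = x $ j - x $ i" by (simp add: axis_def)
        then show False using that \<open>j \<noteq> i\<close> by (simp add: S_def)
      qed
      have nz: "?y s \<noteq> 0" if s: "s \<notin> S" for s
      proof -
        obtain j where "j \<noteq> i"
          using other_index by metis
        then show ?thesis using off[OF s] by (metis zero_index)
      qed
      have D: "((\<lambda>s. W (?y s)) has_real_derivative w (?y s)) (at s)" if "s \<notin> S" for s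
      proof -
        have "((\<lambda>t. m (?y s + t *\<^sub>R axis i 1)) has_real_derivative m' (?y s)) (at 0)"
          using off[OF that] nz[OF that] by (intro deriv) auto
        then have m: "((\<lambda>t. m (?y t)) has_real_derivative m' (?y s)) (at s)"
          using DERIV_shift[of "\<lambda>t. m (?y t)" "m' (?y s)" 0 s] by (simp add: algebra_simps)
        have "((\<lambda>t. norm (v (?y t)) powr p) has_derivative
            (\<lambda>h. p * norm (v (?y s)) powr (p - 2) * (v (?y s) \<bullet> (h *\<^sub>R (g (?y s) $ i))))) (at s)"
          using has_derivative_compose[OF partials_at[of x i s, unfolded has_vector_derivative_def]
              has_derivative_norm_powr[of p "v (?y s)"]] p by simp
        then have n: "((\<lambda>t. norm (v (?y t)) powr p) has_real_derivative
            p * norm (v (?y s)) powr (p - 2) * (v (?y s) \<bullet> (g (?y s) $ i))) (at s)"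
          by (simp add: has_real_derivative_iff_has_vector_derivative has_vector_derivative_def mult_ac)
        show ?thesis unfolding W_def w_def by (rule DERIV_cong[OF DERIV_mult[OF n m]]) simp
      qed
      then show "((\<lambda>s. W (?y s)) has_real_derivative w (?y s)) (at s)" if "s \<notin> S" for s
        using that by simp
      show "continuous_on UNIV (\<lambda>s. W (?y s))"
      proof (rule continuous_at_imp_continuous_on, rule ballI)
        fix s :: real
        show "isCont (\<lambda>s. W (?y s)) s"
        proof (cases "s \<in> S")
          case False
          then show ?thesis using D DERIV_isCont by blast
        next
          case True
          then obtain j where "j \<noteq> i" "s = x $ j - x $ i" unfolding S_def by blast
          then have "j \<noteq> i" "?y s $ i - ?y s $ j = 0" by (simp_all add: axis_def)
          then have v0: "v (?y s) = 0" using C(1)[of i j "?y s"] by auto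
          have "continuous_on UNIV (\<lambda>t. norm (v (?y t)) * B)"
            by (intro continuous_intros continuous_on_compose2[OF v_cont]) auto
          then have "((\<lambda>t. norm (v (?y t)) * B) \<longlongrightarrow> norm (v (?y s)) * B) (at s)"
            by (simp add: continuous_on_eq_continuous_at isCont_def)
          then have "((\<lambda>t. norm (v (?y t)) * B) \<longlongrightarrow> 0) (at s)" by (simp only: v0 norm_zero mult_zero_left)
          moreover have "\<forall>\<^sub>F t in at s. norm (W (?y t)) \<le> norm (v (?y t)) * B"
            by (intro always_eventually allI) (simp only: real_norm_def W_le)
          ultimately have "((\<lambda>t. W (?y t)) \<longlongrightarrow> 0) (at s)"
            by (rule Lim_null_comparison[rotated])
          moreover have "W (?y s) = 0" using v0 by (simp add: W_def)
          ultimately show ?thesis by (simp add: isCont_def)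
        qed
      qed
    qed
  qed
qed

end

section \<open>The Hardy inequality for smooth antisymmetric functions\<close>

context smooth_antisymmetric
begin

text \<open>
  This amounts to a Hardy inequality with exponent 2 and weight \<open>\<bar>x\<bar> powr (2 - p)\<close>
  for \<open>\<bar>v\<bar> powr (p / 2)\<close>. The field
  \<open>\<bar>v\<bar>\<^sup>p \<bar>x\<bar> powr (2 - p) \<nabla>\<phi> / \<phi>\<close> has a divergence with integral zero, which is pointwise at most
  the difference of the two integrands, each taken with its constant. Most of the proof bounds the
  singular terms by powers of \<open>\<bar>v\<bar> / \<bar>x\<bar>\<close> and \<open>\<bar>v\<bar> / \<bar>x $ i - x $ j\<bar>\<close>.
\<close>

lemma integral_weighted_hardy:
  fixes p :: real
  assumes p: "p \<ge> 2"
  defines "d \<equiv> real CARD('n)"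
  shows "integrable lborel (\<lambda>x. (norm (v x) / norm x) powr p)"
    and "integrable lborel (\<lambda>x. (norm (v x) / norm x) powr (p - 2) * (norm (g x))\<^sup>2)"
    and "((d\<^sup>2 - p)\<^sup>2 / 4 + (p - 2) * d * (d - 1) / 2) * (LINT x|lborel. (norm (v x) / norm x) powr p)
      \<le> p\<^sup>2 / 4 * (LINT x|lborel. (norm (v x) / norm x) powr (p - 2) * (norm (g x))\<^sup>2)"
proof -
  obtain C where C: "C > 0" "\<And>x i j. i \<noteq> j \<Longrightarrow> norm (v x) \<le> C * \<bar>x $ i - x $ j\<bar>" "\<And>x. norm (v x) \<le> C * norm x"
    using norm_le_coord_diff by metis
  obtain Mg where Mg: "Mg > 0" "\<And>x. norm (g x) \<le> Mg"
    using bounded_if_zero_outside_ball[OF g_cont g_support[OF less_imp_le]] by metis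
  have [measurable]: "g \<in> borel_measurable borel" using g_cont by (rule borel_measurable_continuous_onI)
  define \<alpha> where "\<alpha> = (p - d\<^sup>2) / 2"
  define Cw where "Cw = (d\<^sup>2 - p)\<^sup>2 / 4 + (p - 2) * d * (d - 1) / 2"
  have ratio: "norm (v x) / norm x \<le> C" for x
    using C(3)[of x] C(1) by (cases "x = 0") (auto simp: divide_simps)
  have ratio_powr: "(norm (v x) / norm x) powr q \<le> C powr q" if "q \<ge> 0" for x q
    using ratio[of x] that by (intro powr_mono2) auto
  show int1: "integrable lborel (\<lambda>x. (norm (v x) / norm x) powr p)"
    by (rule integrable_if_supported[where B="C powr p"]) (use p v_support ratio_powr in auto)
  show int2: "integrable lborel (\<lambda>x. (norm (v x) / norm x) powr (p - 2) * (norm (g x))\<^sup>2)"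
  proof (rule integrable_if_supported[where B="C powr (p - 2) * Mg\<^sup>2"])
    show "\<bar>(norm (v x) / norm x) powr (p - 2) * (norm (g x))\<^sup>2\<bar> \<le> C powr (p - 2) * Mg\<^sup>2" for x
      using ratio_powr[of "p - 2" x] p Mg(2)[of x]
      by (auto simp: abs_mult intro!: mult_mono power_mono)
  qed (use v_support g_support in auto)

  define m where "m i x = norm x powr (2 - p) * ground_log_grad \<alpha> x i" for i and x :: "real^'n"
  define m' where "m' i x = norm x powr (2 - p) *
     ((2 - p) * x $ i / (norm x)\<^sup>2 * ground_log_grad \<alpha> x i + ground_log_grad_deriv \<alpha> x i)" for i and x :: "real^'n"
  have [measurable]: "m i \<in> borel_measurable borel" "m' i \<in> borel_measurable borel" for i
    unfolding m_def m'_def ground_log_grad_def ground_log_grad_deriv_def by measurable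
  have recip: "norm (v x) * \<bar>1 / (x $ i - x $ j)\<bar> \<le> C" for x i j
  proof (cases "x $ i = x $ j")
    case False
    then have "norm (v x) \<le> C * \<bar>x $ i - x $ j\<bar>" using C(2) by metis
    then show ?thesis using False by (simp add: pos_divide_le_eq)
  qed (use C(1) in simp)
  have coord: "norm (v x) * (\<bar>x $ i\<bar> / (norm x)\<^sup>2) \<le> C" for x i
  proof (cases "x = 0")
    case False
    have "norm (v x) * (\<bar>x $ i\<bar> / (norm x)\<^sup>2) = (norm (v x) / norm x) * (\<bar>x $ i\<bar> / norm x)"
      by (simp add: power2_eq_square)
    also have "\<dots> \<le> C * 1"
      using ratio[of x] component_le_norm_cart[of x i] C(1) False by (intro mult_mono) (auto simp: divide_simps)
    finally show ?thesis by simp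
  qed (use C(1) in simp)
  \<comment> \<open>Without the weight \<open>\<bar>x\<bar> powr (2 - p)\<close>, the field is singular to first and its derivative to second order;
    \<open>K\<close> and \<open>K'\<close> bound them after multiplication by \<open>\<bar>v\<bar>\<close> and \<open>\<bar>v\<bar>\<^sup>2\<close>.\<close>
  define K where "K = d * C + \<bar>\<alpha>\<bar> * C"
  have d0: "d \<ge> 0" by (simp add: d_def)
  have rep: "norm (v x) * \<bar>ground_log_grad \<alpha> x i\<bar> \<le> K" for x i
  proof -
    have "norm (v x) * \<bar>ground_log_grad \<alpha> x i\<bar> \<le> norm (v x) * ((\<Sum>j\<in>UNIV. \<bar>1 / (x $ i - x $ j)\<bar>) + \<bar>\<alpha>\<bar> * (\<bar>x $ i\<bar> / (norm x)\<^sup>2))"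
      unfolding ground_log_grad_def
      by (intro mult_left_mono order_trans[OF abs_triangle_ineq] add_mono sum_abs) (auto simp: abs_mult)
    also have "\<dots> = (\<Sum>j\<in>UNIV. norm (v x) * \<bar>1 / (x $ i - x $ j)\<bar>) + \<bar>\<alpha>\<bar> * (norm (v x) * (\<bar>x $ i\<bar> / (norm x)\<^sup>2))"
      by (simp add: distrib_left sum_distrib_left mult_ac)
    also have "\<dots> \<le> (\<Sum>j\<in>(UNIV::'n set). C) + \<bar>\<alpha>\<bar> * C"
      by (intro add_mono sum_mono recip mult_left_mono coord) auto
    finally show ?thesis by (simp add: K_def d_def)
  qed
  have K0: "K \<ge> 0" using C(1) d0 by (simp add: K_def)
  define K' where "K' = (p - 2) * C * K + (d * C\<^sup>2 + \<bar>\<alpha>\<bar> * (3 * C\<^sup>2))"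
  have K'0: "K' \<ge> 0" using C(1) d0 p K0 by (simp add: K'_def)
  have repd: "(norm (v x))\<^sup>2 * \<bar>(2 - p) * x $ i / (norm x)\<^sup>2 * ground_log_grad \<alpha> x i + ground_log_grad_deriv \<alpha> x i\<bar> \<le> K'" for x i
  proof -
    have r2: "(norm (v x) / norm x)\<^sup>2 \<le> C\<^sup>2" using ratio[of x] by (intro power_mono) auto
    have A: "(norm (v x))\<^sup>2 * \<bar>(2 - p) * x $ i / (norm x)\<^sup>2 * ground_log_grad \<alpha> x i\<bar> \<le> (p - 2) * C * K"
    proof -
      have "(norm (v x))\<^sup>2 * \<bar>(2 - p) * x $ i / (norm x)\<^sup>2 * ground_log_grad \<alpha> x i\<bar>
        = (p - 2) * (norm (v x) * (\<bar>x $ i\<bar> / (norm x)\<^sup>2)) * (norm (v x) * \<bar>ground_log_grad \<alpha> x i\<bar>)"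
        using p by (simp add: abs_mult power2_eq_square)
      also have "\<dots> \<le> (p - 2) * C * K"
        using p C(1) by (intro mult_mono rep coord mult_left_mono mult_nonneg_nonneg) auto
      finally show ?thesis .
    qed
    have B: "(norm (v x))\<^sup>2 * \<bar>- (\<Sum>j\<in>UNIV. 1 / (x $ i - x $ j)\<^sup>2)\<bar> \<le> d * C\<^sup>2"
    proof -
      have "(norm (v x))\<^sup>2 * \<bar>- (\<Sum>j\<in>UNIV. 1 / (x $ i - x $ j)\<^sup>2)\<bar> = (\<Sum>j\<in>UNIV. (norm (v x) * \<bar>1 / (x $ i - x $ j)\<bar>)\<^sup>2)"
        by (simp add: sum_nonneg sum_distrib_left power_mult_distrib power_divide abs_of_nonneg)
      also have "\<dots> \<le> (\<Sum>j\<in>(UNIV::'n set). C\<^sup>2)" by (intro sum_mono power_mono recip) auto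
      finally show ?thesis by (simp add: d_def)
    qed
    have D: "(norm (v x))\<^sup>2 * \<bar>\<alpha> * (1 / (norm x)\<^sup>2 - 2 * (x $ i)\<^sup>2 / (norm x)^4)\<bar> \<le> \<bar>\<alpha>\<bar> * (3 * C\<^sup>2)"
    proof -
      have "(norm (v x))\<^sup>2 * \<bar>1 / (norm x)\<^sup>2 - 2 * (x $ i)\<^sup>2 / (norm x)^4\<bar>
        \<le> (norm (v x))\<^sup>2 * (1 / (norm x)\<^sup>2 + 2 * (\<bar>x $ i\<bar> / (norm x)\<^sup>2)\<^sup>2)"
        by (intro mult_left_mono order_trans[OF abs_triangle_ineq4])
          (auto simp: power_divide abs_mult simp flip: power_mult)
      also have "\<dots> = (norm (v x) / norm x)\<^sup>2 + 2 * (norm (v x) * (\<bar>x $ i\<bar> / (norm x)\<^sup>2))\<^sup>2"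
        by (simp add: power_divide power_mult_distrib distrib_left)
      also have "\<dots> \<le> C\<^sup>2 + 2 * C\<^sup>2"
        using r2 power_mono[OF coord, of x i 2] by (intro add_mono mult_left_mono) auto
      finally have "(norm (v x))\<^sup>2 * \<bar>1 / (norm x)\<^sup>2 - 2 * (x $ i)\<^sup>2 / (norm x)^4\<bar> \<le> 3 * C\<^sup>2" by simp
      from mult_left_mono[OF this, of "\<bar>\<alpha>\<bar>"] show ?thesis by (simp add: abs_mult mult_ac)
    qed
    have "(norm (v x))\<^sup>2 * \<bar>(2 - p) * x $ i / (norm x)\<^sup>2 * ground_log_grad \<alpha> x i + ground_log_grad_deriv \<alpha> x i\<bar>
      \<le> (norm (v x))\<^sup>2 * (\<bar>(2 - p) * x $ i / (norm x)\<^sup>2 * ground_log_grad \<alpha> x i\<bar> +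
          (\<bar>- (\<Sum>j\<in>UNIV. 1 / (x $ i - x $ j)\<^sup>2)\<bar> + \<bar>\<alpha> * (1 / (norm x)\<^sup>2 - 2 * (x $ i)\<^sup>2 / (norm x)^4)\<bar>))"
      unfolding ground_log_grad_deriv_def
      by (intro mult_left_mono order_trans[OF abs_triangle_ineq] add_mono) auto
    also have "\<dots> \<le> K'"
      unfolding K'_def distrib_left by (intro add_mono A B D)
    finally show ?thesis .
  qed
  have split1: "norm (v x) powr (p - 1) * norm x powr (2 - p) = (norm (v x) / norm x) powr (p - 2) * norm (v x)" for x
    by (cases "v x = 0 \<or> x = 0") (auto simp: powr_divide powr_diff power2_eq_square field_simps)
  have split2: "norm (v x) powr p * norm x powr (2 - p) = (norm (v x) / norm x) powr (p - 2) * (norm (v x))\<^sup>2" for x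
    by (cases "v x = 0 \<or> x = 0") (auto simp: powr_divide powr_diff power2_eq_square field_simps)
  define B where "B = C powr (p - 2) * (K + K')"
  have B1: "norm (v x) powr (p - 1) * \<bar>m i x\<bar> \<le> B" for x i
  proof -
    have "norm (v x) powr (p - 1) * \<bar>m i x\<bar> = (norm (v x) / norm x) powr (p - 2) * (norm (v x) * \<bar>ground_log_grad \<alpha> x i\<bar>)"
      using split1[of x] by (simp add: m_def abs_mult flip: mult.assoc)
    also have "\<dots> \<le> C powr (p - 2) * (K + K')"
      using p K'0 rep[of x i] by (intro mult_mono ratio_powr) auto
    finally show ?thesis by (simp add: B_def)
  qed
  have B2: "norm (v x) powr p * \<bar>m' i x\<bar> \<le> B" for x i
  proof -
    have "norm (v x) powr p * \<bar>m' i x\<bar> = (norm (v x) / norm x) powr (p - 2) * ((norm (v x))\<^sup>2 * 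
       \<bar>(2 - p) * x $ i / (norm x)\<^sup>2 * ground_log_grad \<alpha> x i + ground_log_grad_deriv \<alpha> x i\<bar>)"
      using split2[of x] by (simp add: m'_def abs_mult flip: mult.assoc)
    also have "\<dots> \<le> C powr (p - 2) * (K + K')"
      using p K0 repd[of x i] by (intro mult_mono ratio_powr) auto
    finally show ?thesis by (simp add: B_def)
  qed
  define w where "w i x = p * norm (v x) powr (p - 2) * (v x \<bullet> g x $ i) * m i x + norm (v x) powr p * m' i x" for i x
  have deriv: "((\<lambda>s. m i (x + s *\<^sub>R axis i 1)) has_real_derivative m' i x) (at 0)"
    if "x \<noteq> 0" "\<And>j. j \<noteq> i \<Longrightarrow> x $ i \<noteq> x $ j" for x i
    unfolding m_def m'_def by (rule weighted_ground_log_grad_has_derivative[OF that])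
  have w: "integrable lborel (w i)" "(LINT x|lborel. w i x) = 0" for i
  proof -
    note * = integral_partial_multiplier[where i=i and m="m i" and m'="m' i", OF p _ _ deriv B1 B2, folded w_def]
    show "integrable lborel (w i)" "(LINT x|lborel. w i x) = 0" by (rule *; measurable)+
  qed
  have pointwise: "(\<Sum>i\<in>UNIV. w i x) \<le> p\<^sup>2 / 4 * ((norm (v x) / norm x) powr (p - 2) * (norm (g x))\<^sup>2) - Cw * (norm (v x) / norm x) powr p" for x
  proof (cases "v x = 0")
    case True
    then show ?thesis using p by (simp add: w_def)
  next
    case False
    then have x0: "x \<noteq> 0" using C(3)[of x] by auto
    have dist: "\<And>i j. i \<noteq> j \<Longrightarrow> x $ i \<noteq> x $ j" using False C(2)[of _ _ x] by fastforce
    define a r b where "a = norm (v x)" and "r = norm x" and "b = norm (g x)"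
    have a: "a > 0" "r > 0" "b \<ge> 0" using False x0 by (auto simp: a_def r_def b_def)
    define S where "S = L2_set (ground_log_grad \<alpha> x) UNIV"
    have S2: "S\<^sup>2 = (\<Sum>i\<in>UNIV. (ground_log_grad \<alpha> x i)\<^sup>2)" by (simp add: S_def L2_set_def sum_nonneg)
    have "(\<Sum>i\<in>UNIV. (v x \<bullet> g x $ i) * ground_log_grad \<alpha> x i) \<le> (\<Sum>i\<in>UNIV. a * (norm (g x $ i) * \<bar>ground_log_grad \<alpha> x i\<bar>))"
    proof (intro sum_mono)
      fix i
      have "(v x \<bullet> g x $ i) * ground_log_grad \<alpha> x i \<le> \<bar>v x \<bullet> g x $ i\<bar> * \<bar>ground_log_grad \<alpha> x i\<bar>"
        by (metis abs_ge_self abs_mult)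
      also have "\<dots> \<le> (norm (v x) * norm (g x $ i)) * \<bar>ground_log_grad \<alpha> x i\<bar>"
        by (intro mult_right_mono Cauchy_Schwarz_ineq2) auto
      finally show "(v x \<bullet> g x $ i) * ground_log_grad \<alpha> x i \<le> a * (norm (g x $ i) * \<bar>ground_log_grad \<alpha> x i\<bar>)"
        by (simp add: a_def mult.assoc)
    qed
    also have "\<dots> = a * (\<Sum>i\<in>UNIV. \<bar>norm (g x $ i)\<bar> * \<bar>ground_log_grad \<alpha> x i\<bar>)" by (simp add: sum_distrib_left)
    also have "\<dots> \<le> a * (b * S)"
      unfolding b_def S_def norm_vec_def using a by (intro mult_left_mono L2_set_mult_ineq) auto
    finally have cs: "(\<Sum>i\<in>UNIV. (v x \<bullet> g x $ i) * ground_log_grad \<alpha> x i) \<le> a * (b * S)" .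
    have "(\<Sum>i\<in>UNIV. p * a powr (p - 2) * (v x \<bullet> g x $ i) * m i x)
        = p * a powr (p - 2) * r powr (2 - p) * (\<Sum>i\<in>UNIV. (v x \<bullet> g x $ i) * ground_log_grad \<alpha> x i)"
      by (simp add: sum_distrib_left m_def r_def mult_ac)
    also have "\<dots> \<le> p * a powr (p - 2) * r powr (2 - p) * (a * (b * S))"
      using p by (intro mult_left_mono cs) auto
    also have "\<dots> = p * a powr (p - 1) * b * (r powr (2 - p) * S)"
      using a by (simp add: powr_diff power2_eq_square field_simps)
    also have "\<dots> \<le> p\<^sup>2 / 4 * ((a / r) powr (p - 2) * b\<^sup>2) + a powr p * r powr (2 - p) * S\<^sup>2"
      by (rule weighted_young) (use a p in auto)
    finally have 1: "(\<Sum>i\<in>UNIV. p * a powr (p - 2) * (v x \<bullet> g x $ i) * m i x) 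
       \<le> p\<^sup>2 / 4 * ((a / r) powr (p - 2) * b\<^sup>2) + a powr p * r powr (2 - p) * S\<^sup>2" .
    have "a powr p * r powr (2 - p) * S\<^sup>2 + (\<Sum>i\<in>UNIV. a powr p * m' i x) = a powr p * r powr (2 - p) *
       (\<Sum>i\<in>UNIV. (2 - p) * x $ i / (norm x)\<^sup>2 * ground_log_grad \<alpha> x i + ground_log_grad_deriv \<alpha> x i + (ground_log_grad \<alpha> x i)\<^sup>2)"
      unfolding S2 m'_def r_def by (simp add: sum_distrib_left sum.distrib distrib_left mult.assoc)
    also have "\<dots> = a powr p * r powr (2 - p) * (- Cw / r\<^sup>2)"
      using sum_ground_log_grad_identity[OF dist x0, of \<alpha> p] unfolding \<alpha>_def d_def Cw_def r_def by simp
    also have "\<dots> = - Cw * (a / r) powr p"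
      using a by (simp add: powr_divide powr_diff field_simps)
    finally have 2: "a powr p * r powr (2 - p) * S\<^sup>2 + (\<Sum>i\<in>UNIV. a powr p * m' i x) = - Cw * (a / r) powr p" .
    have "(\<Sum>i\<in>UNIV. w i x) = (\<Sum>i\<in>UNIV. p * a powr (p - 2) * (v x \<bullet> g x $ i) * m i x) + (\<Sum>i\<in>UNIV. a powr p * m' i x)"
      by (simp add: w_def a_def sum.distrib)
    then show ?thesis using 1 2 by (simp add: a_def b_def r_def)
  qed
  have "0 = (LINT x|lborel. (\<Sum>i\<in>UNIV. w i x))"
    using w by (simp add: Bochner_Integration.integral_sum)
  also have "\<dots> \<le> (LINT x|lborel. p\<^sup>2 / 4 * ((norm (v x) / norm x) powr (p - 2) * (norm (g x))\<^sup>2) - Cw * (norm (v x) / norm x) powr p)"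
    by (intro integral_mono pointwise Bochner_Integration.integrable_diff integrable_mult_right int1 int2
       Bochner_Integration.integrable_sum w)
  also have "\<dots> = p\<^sup>2 / 4 * (LINT x|lborel. (norm (v x) / norm x) powr (p - 2) * (norm (g x))\<^sup>2) - Cw * (LINT x|lborel. (norm (v x) / norm x) powr p)"
    using int1 int2 by simp
  finally show "((d\<^sup>2 - p)\<^sup>2 / 4 + (p - 2) * d * (d - 1) / 2) * (LINT x|lborel. (norm (v x) / norm x) powr p)
      \<le> p\<^sup>2 / 4 * (LINT x|lborel. (norm (v x) / norm x) powr (p - 2) * (norm (g x))\<^sup>2)"
    by (simp add: Cw_def)
qed

text \<open>
  For \<open>p = 2\<close> this is the weighted inequality itself. For \<open>p > 2\<close> the factor \<open>(\<bar>v\<bar> / \<bar>x\<bar>) powr (p - 2)\<close> is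
  separated from \<open>\<bar>g\<bar>\<^sup>2\<close> by the tangent inequality; the tangent point is chosen such that the surplus
  integral of \<open>(\<bar>v\<bar> / \<bar>x\<bar>)\<^sup>p\<close> is absorbed without loss in the constant.
\<close>

lemma hardy_smooth:
  fixes p :: real
  assumes p: "p \<ge> 2"
  shows "ennreal (C_H CARD('n) p) * (\<integral>\<^sup>+ x. ennreal (norm (v x) powr p / norm x powr p) \<partial>lborel)
     \<le> (\<integral>\<^sup>+ x. ennreal (norm (g x) powr p) \<partial>lborel)"
proof -
  define d where "d = real CARD('n)"
  define c where "c = 4 / p\<^sup>2 * ((d\<^sup>2 - p)\<^sup>2 / 4 + (p - 2) * d * (d - 1) / 2)"
  have "d \<ge> 2" using dim by (simp add: d_def)
  then have c0: "c \<ge> 0" using p by (simp add: c_def)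
  define m where "m = p / 2"
  have m: "m \<ge> 1" using p by (simp add: m_def)
  have [measurable]: "g \<in> borel_measurable borel" using g_cont by (rule borel_measurable_continuous_onI)
  obtain Mg where Mg: "Mg > 0" "\<And>x. norm (g x) \<le> Mg"
    using bounded_if_zero_outside_ball[OF g_cont g_support[OF less_imp_le]] by metis
  let ?I = "LINT x|lborel. (norm (v x) / norm x) powr p"
  let ?J = "LINT x|lborel. (norm (v x) / norm x) powr (p - 2) * (norm (g x))\<^sup>2"
  note h = integral_weighted_hardy[OF p, folded d_def]
  have hc: "c * ?I \<le> ?J" 
    using h(3) p by (simp add: c_def field_simps)
  have int3: "integrable lborel (\<lambda>x. norm (g x) powr p)"
  proof (rule integrable_if_supported[where B="Mg powr p"])
    show "\<bar>norm (g x) powr p\<bar> \<le> Mg powr p" for x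
      using p Mg(2)[of x] by (auto intro!: powr_mono2)
  qed (use g_support in auto)
  \<comment> \<open>The tangent inequality for the power \<open>m = p / 2\<close> at the point \<open>c (\<bar>v\<bar> / \<bar>x\<bar>)\<^sup>2\<close>, evaluated at \<open>\<bar>g\<bar>\<^sup>2\<close>;
    it turns the weighted quadratic inequality into the one for \<open>p\<close>-th powers.\<close>
  have pw: "c powr m * (1 - m) * (norm (v x) / norm x) powr p
       + m * c powr (m - 1) * ((norm (v x) / norm x) powr (p - 2) * (norm (g x))\<^sup>2) \<le> norm (g x) powr p" for x
  proof -
    define q where "q = norm (v x) / norm x"
    have q0: "q \<ge> 0" by (simp add: q_def)
    have e: "(q\<^sup>2) powr m = q powr p" "(q\<^sup>2) powr (m - 1) = q powr (p - 2)" "((norm (g x))\<^sup>2) powr m = norm (g x) powr p"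
      using q0 by (cases "q = 0"; cases "norm (g x) = 0"; auto simp: m_def powr_powr simp flip: powr_numeral)+
    have e2: "q powr (p - 2) * q\<^sup>2 = q powr p"
      using q0 by (cases "q = 0") (auto simp: powr_diff)
    have e3: "c powr (m - 1) * c = c powr m"
      using c0 by (cases "c = 0") (auto simp: powr_diff)
    have "(c * q\<^sup>2) powr m + m * (c * q\<^sup>2) powr (m - 1) * ((norm (g x))\<^sup>2 - c * q\<^sup>2) \<le> ((norm (g x))\<^sup>2) powr m"
      by (rule powr_above_tangent) (use m c0 in auto)
    then have "c powr m * q powr p + m * (c powr (m - 1) * q powr (p - 2)) * ((norm (g x))\<^sup>2 - c * q\<^sup>2) \<le> norm (g x) powr p"
      using c0 by (simp add: powr_mult e)
    also have "m * (c powr (m - 1) * q powr (p - 2)) * ((norm (g x))\<^sup>2 - c * q\<^sup>2)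
       = m * c powr (m - 1) * (q powr (p - 2) * (norm (g x))\<^sup>2) - m * (c powr (m - 1) * c) * (q powr (p - 2) * q\<^sup>2)"
      by (simp add: algebra_simps)
    finally show ?thesis unfolding e2 e3 q_def[symmetric] by (simp add: algebra_simps)
  qed
  have e3: "c powr (m - 1) * c = c powr m"
    using c0 by (cases "c = 0") (auto simp: powr_diff)
  have "c powr m * ?I = c powr m * (1 - m) * ?I + m * c powr (m - 1) * (c * ?I)"
    using e3 by (simp add: algebra_simps)
  also have "\<dots> \<le> c powr m * (1 - m) * ?I + m * c powr (m - 1) * ?J"
    using hc m by (intro add_left_mono mult_left_mono) auto
  also have "\<dots> = (LINT x|lborel. c powr m * (1 - m) * (norm (v x) / norm x) powr p
       + m * c powr (m - 1) * ((norm (v x) / norm x) powr (p - 2) * (norm (g x))\<^sup>2))"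
    using h(1,2) by simp
  also have "\<dots> \<le> (LINT x|lborel. norm (g x) powr p)"
    using h(1,2) int3 by (intro integral_mono pw) auto
  finally have main: "c powr m * ?I \<le> (LINT x|lborel. norm (g x) powr p)" .
  have "ennreal (C_H CARD('n) p) * (\<integral>\<^sup>+ x. ennreal (norm (v x) powr p / norm x powr p) \<partial>lborel)
     = ennreal (c powr m) * (\<integral>\<^sup>+ x. ennreal ((norm (v x) / norm x) powr p) \<partial>lborel)"
    by (simp add: C_H_eq[OF p] c_def m_def d_def powr_divide)
  also have "\<dots> = ennreal (c powr m * ?I)"
    using h(1) by (simp add: nn_integral_eq_integral ennreal_mult)
  also have "\<dots> \<le> ennreal (LINT x|lborel. norm (g x) powr p)" using main by (rule ennreal_leI)
  also have "\<dots> = (\<integral>\<^sup>+ x. ennreal (norm (g x) powr p) \<partial>lborel)"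
    using int3 by (simp add: nn_integral_eq_integral)
  finally show ?thesis .
qed

end

section \<open>Smooth bumps on cubes\<close>

text \<open>
  A one-variable counterpart of \<^const>\<open>C_k\<close>, from which the smoothness of product functions on the
  whole space is derived.
\<close>

primrec times_differentiable :: "nat \<Rightarrow> (real \<Rightarrow> real) \<Rightarrow> bool" where
  "times_differentiable 0 f \<longleftrightarrow> continuous_on UNIV f"
| "times_differentiable (Suc k) f \<longleftrightarrow> (\<exists>f'. (\<forall>x. (f has_real_derivative f' x) (at x)) \<and> times_differentiable k f')"

lemma times_differentiable_SucD: "times_differentiable (Suc k) f \<Longrightarrow> times_differentiable k f"
proof (induction k arbitrary: f)
  case 0
  then obtain f' where "\<And>x. (f has_real_derivative f' x) (at x)" by auto
  then show ?case by (auto intro: DERIV_continuous_on[of UNIV f f'])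
next
  case (Suc k)
  then show ?case by (metis times_differentiable.simps(2))
qed

lemma times_differentiable_const: "times_differentiable k (\<lambda>_. c)"
  by (induction k arbitrary: c) (auto intro!: exI[of _ "\<lambda>_. 0"])

lemma times_differentiable_add:
  "times_differentiable k f \<Longrightarrow> times_differentiable k h \<Longrightarrow> times_differentiable k (\<lambda>x. f x + h x)"
proof (induction k arbitrary: f h)
  case (Suc k)
  then obtain f' h' where "\<forall>x. (f has_real_derivative f' x) (at x)" "times_differentiable k f'"
    "\<forall>x. (h has_real_derivative h' x) (at x)" "times_differentiable k h'" by auto
  then show ?case using Suc.IH
    by (auto intro!: exI[of _ "\<lambda>x. f' x + h' x"] derivative_intros)
qed (simp add: continuous_on_add)

lemma times_differentiable_mult:
  "times_differentiable k f \<Longrightarrow> times_differentiable k h \<Longrightarrow> times_differentiable k (\<lambda>x. f x * h x)"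
proof (induction k arbitrary: f h)
  case (Suc k)
  then obtain f' h' where *: "\<forall>x. (f has_real_derivative f' x) (at x)" "times_differentiable k f'"
    "\<forall>x. (h has_real_derivative h' x) (at x)" "times_differentiable k h'" by auto
  have "times_differentiable k (\<lambda>x. f' x * h x + h' x * f x)"
    by (intro times_differentiable_add Suc.IH * Suc.prems[THEN times_differentiable_SucD])
  moreover have "\<forall>x. ((\<lambda>x. f x * h x) has_real_derivative f' x * h x + h' x * f x) (at x)"
    using * by (intro allI DERIV_mult) blast+
  ultimately show ?case unfolding times_differentiable.simps by (intro exI[of _ "\<lambda>x. f' x * h x + h' x * f x"] conjI)
qed (simp add: continuous_on_mult)

lemma times_differentiable_affine:
  "times_differentiable k f \<Longrightarrow> times_differentiable k (\<lambda>x. f (a * x + b))"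
proof (induction k arbitrary: f)
  case 0
  then show ?case by (auto intro!: continuous_on_compose2[of UNIV f] continuous_intros)
next
  case (Suc k)
  then obtain f' where *: "\<forall>x. (f has_real_derivative f' x) (at x)" "times_differentiable k f'" by auto
  have "times_differentiable k (\<lambda>x. a * f' (a * x + b))"
    using Suc.IH[OF *(2)] by (intro times_differentiable_mult times_differentiable_const)
  moreover have "((\<lambda>x. f (a * x + b)) has_real_derivative a * f' (a * x + b)) (at x)" for x
  proof -
    have "((\<lambda>x. a * x + b) has_real_derivative a) (at x)" by (auto intro!: derivative_eq_intros)
    from DERIV_chain2[OF *(1)[rule_format] this] show ?thesis by (simp add: mult.commute)
  qed
  ultimately show ?case unfolding times_differentiable.simps by (intro exI[of _ "\<lambda>x. a * f' (a * x + b)"]) simp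
qed

text \<open>
  The derivatives of \<open>exp (- 1 / t)\<close>, extended by zero, stay within this family:
  with \<open>s = 1 / t\<close> they replace \<open>P\<close> by \<open>s\<^sup>2 (P - P')\<close>.
\<close>

definition flat_exp :: "real poly \<Rightarrow> real \<Rightarrow> real" where
  "flat_exp P t = (if t \<le> 0 then 0 else poly P (1 / t) * exp (- (1 / t)))"

lemma poly_times_exp_neg_tendsto_0: "((\<lambda>s. poly P s * exp (- s)) \<longlongrightarrow> (0::real)) at_top"
proof -
  have "((\<lambda>s. \<Sum>i\<le>degree P. coeff P i * (s ^ i / exp s)) \<longlongrightarrow> (\<Sum>i\<le>degree P. coeff P i * 0)) at_top"
    by (intro tendsto_intros tendsto_power_div_exp_0)
  then show ?thesis
    by (simp add: poly_altdef exp_minus divide_inverse sum_distrib_right mult.assoc)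
qed

lemma flat_exp_tendsto: "(flat_exp P \<longlongrightarrow> 0) (at 0)"
proof -
  have r: "((\<lambda>t. poly P (1 / t) * exp (- (1 / t))) \<longlongrightarrow> 0) (at_right 0)"
    using filterlim_compose[OF poly_times_exp_neg_tendsto_0 filterlim_inverse_at_top_right, of P]
    by (simp add: inverse_eq_divide)
  have "(flat_exp P \<longlongrightarrow> 0) (at_right 0)"
    by (rule Lim_transform_eventually[OF r]) (auto simp: flat_exp_def eventually_at_filter)
  moreover have "(flat_exp P \<longlongrightarrow> 0) (at_left 0)"
    by (rule Lim_transform_eventually[OF tendsto_const]) (auto simp: flat_exp_def eventually_at_filter)
  ultimately show ?thesis by (simp add: filterlim_split_at)
qed

lemma flat_exp_has_derivative:
  "(flat_exp P has_real_derivative flat_exp ([:0, 0, 1:] * (P - pderiv P)) t) (at t)"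
proof (cases t "0::real" rule: linorder_cases)
  case less
  have "((\<lambda>_. 0) has_real_derivative 0) (at t)" by simp
  then have "(flat_exp P has_real_derivative 0) (at t)"
    by (rule has_field_derivative_transform_within_open[where S="{..<0}"]) (use less in \<open>auto simp: flat_exp_def\<close>)
  then show ?thesis using less by (simp add: flat_exp_def)
next
  case greater
  have "((\<lambda>t. poly P (1 / t) * exp (- (1 / t))) has_real_derivative
     poly P (1 / t) * (exp (- (1 / t)) * (1 / t\<^sup>2)) + (- (1 / t\<^sup>2) * poly (pderiv P) (1 / t)) * exp (- (1 / t))) (at t)"
  proof -
    have i: "((\<lambda>t. 1 / t) has_real_derivative - (1 / t\<^sup>2)) (at t)"
      using greater by (auto intro!: derivative_eq_intros simp: power2_eq_square)
    have e: "((\<lambda>t. exp (- (1 / t))) has_real_derivative exp (- (1 / t)) * (1 / t\<^sup>2)) (at t)"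
      using DERIV_fun_exp[OF DERIV_minus[OF i]] by simp
    have "((\<lambda>t. poly P (1 / t)) has_real_derivative poly (pderiv P) (1 / t) * - (1 / t\<^sup>2)) (at t)"
      using DERIV_chain2[OF poly_DERIV i] .
    from DERIV_mult[OF this e] show ?thesis by (simp add: mult_ac)
  qed
  then have "(flat_exp P has_real_derivative
     poly P (1 / t) * (exp (- (1 / t)) * (1 / t\<^sup>2)) + (- (1 / t\<^sup>2) * poly (pderiv P) (1 / t)) * exp (- (1 / t))) (at t)"
    by (rule has_field_derivative_transform_within_open[where S="{0<..}"]) (use greater in \<open>auto simp: flat_exp_def\<close>)
  then show ?thesis
    by (rule DERIV_cong) (use greater in \<open>simp add: flat_exp_def field_simps power2_eq_square\<close>)
next
  case equal
  have "((\<lambda>h. (flat_exp P (0 + h) - flat_exp P 0) / h) \<longlongrightarrow> 0) (at 0)"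
  proof (rule Lim_transform_eventually[OF flat_exp_tendsto[of "[:0, 1:] * P"]])
    show "\<forall>\<^sub>F h in at 0. flat_exp ([:0, 1:] * P) h = (flat_exp P (0 + h) - flat_exp P 0) / h"
      by (auto simp: flat_exp_def eventually_at_filter)
  qed
  then show ?thesis using equal by (simp add: DERIV_def flat_exp_def)
qed

lemma times_differentiable_flat_exp: "times_differentiable k (flat_exp P)"
proof (induction k arbitrary: P)
  case 0
  show ?case by (auto intro!: continuous_at_imp_continuous_on DERIV_isCont flat_exp_has_derivative)
next
  case (Suc k)
  show ?case using flat_exp_has_derivative Suc.IH
    by (auto intro!: exI[of _ "flat_exp ([:0, 0, 1:] * (P - pderiv P))"])
qed

text \<open>
  Smooth, and positive exactly on the open unit interval. The mollifier is built as a product of such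
  bumps over the coordinates rather than as a radial function: it is still invariant under
  permutations, and its support is a cube with a corner at the origin, as in the cube averages of
  the differentiation theorem.
\<close>

definition bump :: "real \<Rightarrow> real" where
  "bump t = flat_exp 1 t * flat_exp 1 (1 - t)"

lemma times_differentiable_bump: "times_differentiable k bump"
proof -
  have "times_differentiable k (\<lambda>t. flat_exp 1 t * flat_exp 1 ((-1) * t + 1))"
    by (intro times_differentiable_mult times_differentiable_affine times_differentiable_flat_exp)
  then show ?thesis by (simp add: bump_def[abs_def])
qed

lemma bump_nonneg: "bump t \<ge> 0"
  by (simp add: bump_def flat_exp_def)

lemma bump_le_1: "bump t \<le> 1"
  by (auto simp: bump_def flat_exp_def mult_le_one)

lemma bump_pos: "0 < t \<Longrightarrow> t < 1 \<Longrightarrow> bump t > 0"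
  by (simp add: bump_def flat_exp_def)

lemma bump_eq_0: "t \<le> 0 \<or> t \<ge> 1 \<Longrightarrow> bump t = 0"
  by (auto simp: bump_def flat_exp_def)

text \<open>
  A partial derivative of a product of one-variable functions is again such a product, with one factor
  differentiated; so the induction on the order goes through without a Leibniz formula.
\<close>

lemma prod_times_differentiable_C_k:
  fixes f :: "'n::finite \<Rightarrow> real \<Rightarrow> real"
  assumes "\<And>i. times_differentiable k (f i)"
  shows "C_k k (\<lambda>x::real^'n. \<Prod>i\<in>UNIV. f i (x $ i))"
  using assms
proof (induction k arbitrary: f)
  case 0
  have "continuous_on UNIV (\<lambda>x::real^'n. f i (x $ i))" for i
    by (rule continuous_on_compose2[of UNIV "f i"]) (use 0[of i] in \<open>auto intro: continuous_intros\<close>)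
  then show ?case by (simp add: continuous_on_prod)
next
  case (Suc k)
  then have "\<forall>i. \<exists>f'. (\<forall>x. (f i has_real_derivative f' x) (at x)) \<and> times_differentiable k f'" by simp
  then obtain f' where f': "\<And>i x. (f i has_real_derivative f' i x) (at x)" "\<And>i. times_differentiable k (f' i)"
    by metis
  have D: "((\<lambda>x::real^'n. \<Prod>i\<in>UNIV. f i (x $ i)) has_derivative
     (\<lambda>h. \<Sum>i\<in>UNIV. (f' i (x $ i) * (h $ i)) * (\<Prod>j\<in>UNIV - {i}. f j (x $ j)))) (at x)" for x
  proof (rule has_derivative_prod)
    fix i :: 'n
    show "((\<lambda>x. f i (x $ i)) has_derivative (\<lambda>h. f' i (x $ i) * (h $ i))) (at x)"
      by (rule has_derivative_compose[OF bounded_linear_imp_has_derivative[OF bounded_linear_vec_nth]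
            f'(1)[of i "x $ i", unfolded has_field_derivative_def]])
  qed
  have P: "partial i (\<lambda>x::real^'n. \<Prod>i\<in>UNIV. f i (x $ i)) = (\<lambda>x. \<Prod>j\<in>UNIV. (f(i := f' i)) j (x $ j))" for i
  proof
    fix x :: "real^'n"
    have "partial i (\<lambda>x::real^'n. \<Prod>i\<in>UNIV. f i (x $ i)) x =
       (\<Sum>j\<in>UNIV. (f' j (x $ j) * (axis i 1 $ j)) * (\<Prod>j\<in>UNIV - {j}. f j (x $ j)))"
      unfolding partial_def frechet_derivative_at[OF D, symmetric] by simp
    also have "\<dots> = (\<Sum>j\<in>UNIV. if j = i then f' i (x $ i) * (\<Prod>j\<in>UNIV - {i}. f j (x $ j)) else 0)"
      by (intro sum.cong) (auto simp: axis_def)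
    also have "\<dots> = f' i (x $ i) * (\<Prod>j\<in>UNIV - {i}. f j (x $ j))" by simp
    also have "\<dots> = (\<Prod>j\<in>UNIV. (f(i := f' i)) j (x $ j))"
      by (subst prod.remove[of UNIV i]) auto
    finally show "partial i (\<lambda>x::real^'n. \<Prod>i\<in>UNIV. f i (x $ i)) x = (\<Prod>j\<in>UNIV. (f(i := f' i)) j (x $ j))" .
  qed
  have "times_differentiable k ((f(i := f' i)) j)" for i j
    using f'(2) Suc.prems times_differentiable_SucD[of k "f j"] by auto
  then show ?case
    using D by (auto simp: P differentiable_def simp del: fun_upd_apply intro!: Suc.IH)
qed

definition cube_bump :: "real \<Rightarrow> real^'n::finite \<Rightarrow> real" where
  "cube_bump c z = (\<Prod>i\<in>UNIV. bump (c * z $ i))"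

lemma cube_bump_nonneg: "cube_bump c z \<ge> 0"
  by (simp add: cube_bump_def prod_nonneg bump_nonneg)

lemma cube_bump_le_1: "cube_bump c z \<le> 1"
  by (simp add: cube_bump_def prod_le_1 bump_nonneg bump_le_1)

lemma cube_bump_support:
  assumes "c > 0" "cube_bump c z \<noteq> 0"
  shows "z \<in> cbox 0 (\<chi> i. 1 / c)"
proof -
  have "0 \<le> z $ i \<and> z $ i \<le> 1 / c" for i
  proof -
    have "bump (c * z $ i) \<noteq> 0" using assms(2) by (simp add: cube_bump_def)
    then have "0 < c * z $ i" "c * z $ i < 1" using bump_eq_0[of "c * z $ i"] by linarith+
    then show ?thesis using assms(1) by (simp add: field_simps zero_less_mult_iff)
  qed
  then show ?thesis by (simp add: mem_box_cart)
qed

lemma translated_cube_bump_test_function: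
  assumes "c > 0"
  shows "(\<lambda>y::real^'n::finite. cube_bump c (y - x)) \<in> test_functions"
proof -
  have "C_k k (\<lambda>y. cube_bump c (y - x))" for k
  proof -
    have "times_differentiable k (\<lambda>t. bump (c * t + - (c * x $ i)))" for i
      by (intro times_differentiable_affine times_differentiable_bump)
    from prod_times_differentiable_C_k[OF this] show ?thesis
      by (simp add: cube_bump_def right_diff_distrib)
  qed
  moreover have "compact (closure {y. cube_bump c (y - x) \<noteq> 0})"
  proof (rule compact_closure[THEN iffD2], rule bounded_subset)
    show "bounded ((+) x ` cbox 0 (\<chi> i. 1 / c))" by (intro bounded_translation bounded_cbox)
    show "{y. cube_bump c (y - x) \<noteq> 0} \<subseteq> (+) x ` cbox 0 (\<chi> i. 1 / c)"
    proof
      fix y assume "y \<in> {y. cube_bump c (y - x) \<noteq> 0}"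
      then have "y - x \<in> cbox 0 (\<chi> i. 1 / c)" using cube_bump_support[OF assms] by blast
      then show "y \<in> (+) x ` cbox 0 (\<chi> i. 1 / c)" by (force simp: image_iff intro!: bexI[of _ "y - x"])
    qed
  qed
  ultimately show ?thesis by (simp add: test_functions_def)
qed

section \<open>Mollification of locally integrable functions\<close>

text \<open>
  Correlation in place of convolution: \<open>k\<close> is evaluated at \<open>y - x\<close>, so that \<open>y \<mapsto> k (y - x)\<close>, without a
  reflection of \<open>k\<close>, is the test function that yields the value at \<open>x\<close>.
\<close>

definition correlate :: "('a::euclidean_space \<Rightarrow> real) \<Rightarrow> ('a \<Rightarrow> 'b::euclidean_space) \<Rightarrow> 'a \<Rightarrow> 'b" where
  "correlate k u x = (LINT y|lborel. k (y - x) *\<^sub>R u y)"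

lemma lborel_distr_reflect:
  fixes y :: "'a::euclidean_space"
  shows "distr lborel borel (\<lambda>x. y - x) = lborel"
  using lborel_affine[of "-1" y] by (simp add: density_1)

lemma lborel_integral_scale:
  fixes f :: "'a::euclidean_space \<Rightarrow> real"
  assumes "c > 0" "f \<in> borel_measurable borel"
  shows "(LINT x|lborel. f (c *\<^sub>R x)) = (LINT x|lborel. f x) / c ^ DIM('a)"
proof -
  have "(LINT x|lborel. f x) = (LINT x|density (distr lborel borel (\<lambda>x. 0 + c *\<^sub>R x)) (\<lambda>_. ennreal (c ^ DIM('a))). f x)"
    using lborel_affine[of c "0::'a"] assms(1) by (simp add: ennreal_power)
  also have "\<dots> = (LINT x|distr lborel borel (\<lambda>x. 0 + c *\<^sub>R x). c ^ DIM('a) *\<^sub>R f x)"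
    using assms by (subst integral_density) auto
  also have "\<dots> = c ^ DIM('a) * (LINT x|lborel. f (c *\<^sub>R x))"
    using assms by (subst integral_distr) auto
  finally show ?thesis using assms(1) by (simp add: field_simps)
qed

locale mollification =
  fixes u :: "'a::euclidean_space \<Rightarrow> 'b::euclidean_space"
  assumes borel_u [measurable]: "u \<in> borel_measurable borel"
    and local_int: "\<And>r. set_integrable lborel (cball 0 r) u"
begin

lemma integrable_dominating: "integrable lborel (\<lambda>y. M * indicator (cball 0 r) y * norm (u y))"
proof -
  have "integrable lborel (\<lambda>y. M * norm (indicator (cball 0 r) y *\<^sub>R u y))"
    using local_int[of r] unfolding set_integrable_def by (intro integrable_mult_right integrable_norm)
  then show ?thesis by (simp add: mult.assoc)
qed

lemma kernel_dominated:
  assumes "\<And>z. norm z > r \<Longrightarrow> k z = 0" "\<And>z. \<bar>k z\<bar> \<le> M" "norm x \<le> s"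
  shows "norm (k (y - x) *\<^sub>R u y) \<le> M * indicator (cball 0 (s + r)) y * norm (u y)"
proof (cases "norm y \<le> s + r")
  case True
  then show ?thesis using assms(2)[of "y - x"] by (simp add: mult_right_mono)
next
  case False
  then have "norm (y - x) > r" using assms(3) norm_triangle_sub[of y x] by linarith
  then show ?thesis using assms(1) False by simp
qed

lemma integrable_kernel:
  assumes [measurable]: "k \<in> borel_measurable borel"
    and k: "\<And>z. norm z > r \<Longrightarrow> k z = 0" "\<And>z. \<bar>k z\<bar> \<le> M"
  shows "integrable lborel (\<lambda>y. k (y - x) *\<^sub>R u y)"
proof (rule Bochner_Integration.integrable_bound[OF integrable_dominating[of M "norm x + r"]])
  show "AE y in lborel. norm (k (y - x) *\<^sub>R u y) \<le> norm (M * indicator (cball 0 (norm x + r)) y * norm (u y))"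
  proof (rule AE_I2)
    fix y
    have "norm (k (y - x) *\<^sub>R u y) \<le> M * indicator (cball 0 (norm x + r)) y * norm (u y)"
      by (rule kernel_dominated[OF k order_refl])
    then show "norm (k (y - x) *\<^sub>R u y) \<le> norm (M * indicator (cball 0 (norm x + r)) y * norm (u y))" by simp
  qed
qed measurable

lemma continuous_correlate:
  assumes kc: "continuous_on UNIV k"
    and k: "\<And>z. norm z > r \<Longrightarrow> k z = 0" "\<And>z. \<bar>k z\<bar> \<le> M"
  shows "continuous_on UNIV (correlate k u)"
proof (rule continuous_on_sequentiallyI)
  fix X :: "nat \<Rightarrow> 'a" and x assume X: "X \<longlonglongrightarrow> x"
  have [measurable]: "k \<in> borel_measurable borel" using kc by (rule borel_measurable_continuous_onI)
  obtain s where s: "\<And>n. norm (X n) \<le> s"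
    using convergent_imp_bounded[OF X] by (auto simp: bounded_iff)
  show "(\<lambda>n. correlate k u (X n)) \<longlonglongrightarrow> correlate k u x"
    unfolding correlate_def
  proof (rule integral_dominated_convergence[where w="\<lambda>y. M * indicator (cball 0 (s + r)) y * norm (u y)"])
    show "integrable lborel (\<lambda>y. M * indicator (cball 0 (s + r)) y * norm (u y))" by (rule integrable_dominating)
    show "AE y in lborel. (\<lambda>n. k (y - X n) *\<^sub>R u y) \<longlonglongrightarrow> k (y - x) *\<^sub>R u y"
    proof (intro AE_I2 tendsto_scaleR tendsto_const)
      fix y
      have "isCont k (y - x)" using kc by (simp add: continuous_on_eq_continuous_at)
      then show "(\<lambda>n. k (y - X n)) \<longlonglongrightarrow> k (y - x)"
        by (rule isCont_tendsto_compose) (intro tendsto_intros X)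
    qed
    show "AE y in lborel. norm (k (y - X n) *\<^sub>R u y) \<le> M * indicator (cball 0 (s + r)) y * norm (u y)" for n
      by (intro AE_I2 kernel_dominated k s)
  qed measurable
qed

text \<open>
  The derivative falls on the kernel; difference quotients of \<open>k\<close> are
  dominated because \<open>k\<close> is Lipschitz with bounded support.
\<close>

lemma correlate_has_directional_derivative:
  assumes kc: "continuous_on UNIV k" and k'c: "continuous_on UNIV k'"
    and deriv: "\<And>z. ((\<lambda>s. k (z + s *\<^sub>R e)) has_real_derivative k' z) (at 0)"
    and k: "\<And>z. norm z > r \<Longrightarrow> k z = 0" "\<And>z. \<bar>k z\<bar> \<le> M"
    and k': "\<And>z. norm z > r \<Longrightarrow> k' z = 0" "\<And>z. \<bar>k' z\<bar> \<le> M"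
  shows "((\<lambda>s. correlate k u (x + s *\<^sub>R e)) has_vector_derivative - correlate k' u x) (at 0)"
proof -
  have [measurable]: "k \<in> borel_measurable borel" "k' \<in> borel_measurable borel"
    using kc k'c by (auto intro: borel_measurable_continuous_onI)
  have deriv': "((\<lambda>s. k (z + s *\<^sub>R e)) has_real_derivative k' (z + t *\<^sub>R e)) (at t)" for z t
    using deriv[of "z + t *\<^sub>R e"] DERIV_shift[of "\<lambda>s. k (z + s *\<^sub>R e)" _ 0 t]
    by (simp add: algebra_simps)
  have lip: "\<bar>k (z + t *\<^sub>R e) - k z\<bar> \<le> M * \<bar>t\<bar>" for z t
  proof -
    have "norm ((\<lambda>s. k (z + s *\<^sub>R e)) t - (\<lambda>s. k (z + s *\<^sub>R e)) 0) \<le> M * norm (t - 0)"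
      by (rule field_differentiable_bound[of UNIV])
        (use deriv' k'(2) in \<open>auto intro: has_field_derivative_at_within\<close>)
    then show ?thesis by simp
  qed
  define q where "q h y = (k (y - x - h *\<^sub>R e) - k (y - x)) / h" for h :: real and y
  have quot: "(correlate k u (x + h *\<^sub>R e) - correlate k u x) /\<^sub>R h = (LINT y|lborel. q h y *\<^sub>R u y)" for h
  proof -
    have "correlate k u (x + h *\<^sub>R e) - correlate k u x = 
       (LINT y|lborel. k (y - (x + h *\<^sub>R e)) *\<^sub>R u y - k (y - x) *\<^sub>R u y)"
      unfolding correlate_def by (intro Bochner_Integration.integral_diff[symmetric] integrable_kernel[OF _ k]) auto
    then show ?thesis
      by (simp add: q_def divide_inverse mult.commute scaleR_diff_left diff_diff_eq flip: integral_scaleR_right scaleR_scaleR)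
  qed
  have "((\<lambda>h. (correlate k u (x + h *\<^sub>R e) - correlate k u x) /\<^sub>R h) \<longlongrightarrow> - correlate k' u x) (at 0)"
    unfolding quot tendsto_at_iff_sequentially o_def
  proof (intro allI impI)
    fix H :: "nat \<Rightarrow> real" assume H0: "\<forall>i. H i \<in> UNIV - {0}" and H: "H \<longlonglongrightarrow> 0"
    obtain s where s: "\<And>n. \<bar>H n\<bar> \<le> s"
      using convergent_imp_bounded[OF H] by (auto simp: bounded_iff)
    have dom: "norm (q (H n) y *\<^sub>R u y) \<le> M * indicator (cball 0 (norm x + s * norm e + r)) y * norm (u y)" for n y
    proof (cases "norm y \<le> norm x + s * norm e + r")
      case True
      have "\<bar>q (H n) y\<bar> \<le> M"
        using lip[of "y - x" "- H n"] H0 by (simp add: q_def divide_le_eq)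
      then show ?thesis using True by (simp add: mult_right_mono)
    next
      case False
      have "\<bar>H n\<bar> * norm e \<le> s * norm e" using s by (intro mult_right_mono) auto
      moreover have "norm y \<le> norm (y - x) + norm x" "norm (y - x) \<le> norm (y - x - H n *\<^sub>R e) + \<bar>H n\<bar> * norm e"
        using norm_triangle_sub[of y x] norm_triangle_sub[of "y - x" "H n *\<^sub>R e"] by simp_all
      moreover have "0 \<le> \<bar>H n\<bar> * norm e" by simp
      ultimately have "norm (y - x) > r" "norm (y - x - H n *\<^sub>R e) > r" using False by linarith+
      then show ?thesis using k(1) False by (simp add: q_def)
    qed
    have "(\<lambda>n. LINT y|lborel. q (H n) y *\<^sub>R u y) \<longlonglongrightarrow> (LINT y|lborel. (- k' (y - x)) *\<^sub>R u y)"
    proof (rule integral_dominated_convergence[where w="\<lambda>y. M * indicator (cball 0 (norm x + s * norm e + r)) y * norm (u y)"])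
      show "AE y in lborel. (\<lambda>n. q (H n) y *\<^sub>R u y) \<longlonglongrightarrow> (- k' (y - x)) *\<^sub>R u y"
      proof (intro AE_I2 tendsto_scaleR tendsto_const)
        fix y
        have "((\<lambda>h. (k (y - x + h *\<^sub>R e) - k (y - x)) / h) \<longlongrightarrow> k' (y - x)) (at 0)"
          using deriv[of "y - x"] by (simp add: DERIV_def)
        moreover have "filterlim (\<lambda>n. - H n) (at 0) sequentially"
          using H0 tendsto_minus[OF H] by (simp add: filterlim_at)
        ultimately have "(\<lambda>n. (k (y - x + (- H n) *\<^sub>R e) - k (y - x)) / (- H n)) \<longlonglongrightarrow> k' (y - x)"
          by (rule filterlim_compose)
        from tendsto_minus[OF this] show "(\<lambda>n. q (H n) y) \<longlonglongrightarrow> - k' (y - x)"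
          by (simp add: q_def)
      qed
      show "AE y in lborel. norm (q (H n) y *\<^sub>R u y) \<le> M * indicator (cball 0 (norm x + s * norm e + r)) y * norm (u y)" for n
        by (intro AE_I2 dom)
      show "(\<lambda>y. q (H n) y *\<^sub>R u y) \<in> borel_measurable lborel" for n unfolding q_def by measurable
    qed (use integrable_dominating in measurable)
    then show "(\<lambda>n. LINT y|lborel. q (H n) y *\<^sub>R u y) \<longlonglongrightarrow> - correlate k' u x"
      by (simp add: correlate_def)
  qed
  then have "((\<lambda>h. norm ((correlate k u (x + h *\<^sub>R e) - correlate k u x) /\<^sub>R h - (- correlate k' u x))) \<longlongrightarrow> 0) (at 0)"
    by (intro tendsto_norm_zero LIM_zero)
  moreover have "\<forall>\<^sub>F h in at 0. norm ((correlate k u (x + h *\<^sub>R e) - correlate k u x) /\<^sub>R h - (- correlate k' u x))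
     = norm (correlate k u (x + (0 + h) *\<^sub>R e) - correlate k u (x + 0 *\<^sub>R e) - h *\<^sub>R (- correlate k' u x)) / norm h"
  proof (unfold eventually_at_filter, rule always_eventually, intro allI impI)
    fix h :: real assume "h \<noteq> 0"
    define A where "A = correlate k u (x + h *\<^sub>R e) - correlate k u x"
    have "A /\<^sub>R h - (- correlate k' u x) = (A - h *\<^sub>R (- correlate k' u x)) /\<^sub>R h"
      using \<open>h \<noteq> 0\<close> by (simp add: algebra_simps)
    then show "norm ((correlate k u (x + h *\<^sub>R e) - correlate k u x) /\<^sub>R h - (- correlate k' u x))
     = norm (correlate k u (x + (0 + h) *\<^sub>R e) - correlate k u (x + 0 *\<^sub>R e) - h *\<^sub>R (- correlate k' u x)) / norm h"
      by (simp add: A_def divide_inverse mult.commute)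
  qed
  ultimately show ?thesis
    unfolding has_vector_derivative_def has_derivative_at
    by (intro conjI bounded_linear_scaleR_left) (rule Lim_transform_eventually)
qed

text \<open>
  Jensen's inequality at each point, then Tonelli. For the gradients
  this contraction property takes the place of a convergence statement.
\<close>

lemma nn_integral_correlate_powr_le:
  assumes p: "p \<ge> 1"
    and [measurable]: "k \<in> borel_measurable borel"
    and k0: "\<And>z. k z \<ge> 0" and int_k: "(\<integral>\<^sup>+z. ennreal (k z) \<partial>lborel) = 1"
    and k: "\<And>z. norm z > r \<Longrightarrow> k z = 0" "\<And>z. k z \<le> M"
  shows "(\<integral>\<^sup>+x. ennreal (norm (correlate k u x) powr p) \<partial>lborel) \<le> (\<integral>\<^sup>+y. ennreal (norm (u y) powr p) \<partial>lborel)"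
proof -
  have refl: "(\<integral>\<^sup>+x. ennreal (k (y - x)) \<partial>lborel) = 1" for y
  proof -
    have "(\<integral>\<^sup>+x. ennreal (k (y - x)) \<partial>lborel) = (\<integral>\<^sup>+z. ennreal (k z) \<partial>distr lborel borel (\<lambda>x. y - x))"
      by (subst nn_integral_distr) auto
    then show ?thesis by (simp add: lborel_distr_reflect int_k)
  qed
  have kM: "\<bar>k z\<bar> \<le> M" for z using k0 k(2) by simp
  have trans: "(\<integral>\<^sup>+y. ennreal (k (y - x)) \<partial>lborel) = 1" for x
  proof -
    have eq: "distr lborel borel (\<lambda>y. y - x) = (lborel :: 'a measure)"
      using lborel_distr_plus[of "-x"] by (metis (no_types, lifting) add.commute diff_conv_add_uminus ext)
    have "(\<integral>\<^sup>+y. ennreal (k (y - x)) \<partial>lborel) = (\<integral>\<^sup>+z. ennreal (k z) \<partial>distr lborel borel (\<lambda>y. y - x))"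
      by (subst nn_integral_distr) auto
    then show ?thesis by (simp add: eq int_k)
  qed
  have jensen: "ennreal (norm (correlate k u x) powr p) \<le> (\<integral>\<^sup>+y. ennreal (k (y - x)) * ennreal (norm (u y) powr p) \<partial>lborel)" for x
  proof (cases "(\<integral>\<^sup>+y. ennreal (k (y - x) * norm (u y) powr p) \<partial>lborel) = \<infinity>")
    case True
    then show ?thesis using k0 by (simp add: ennreal_mult)
  next
    case False
    have ip: "integrable lborel (\<lambda>y. k (y - x) * norm (u y) powr p)"
      using False k0 by (intro integrableI_nonneg) (auto simp: less_top)
    have i1: "integrable lborel (\<lambda>y. k (y - x) * norm (u y))"
      using integrable_norm[OF integrable_kernel[of k r M x]] k(1) kM k0 by simp
    have i0: "integrable lborel (\<lambda>y. k (y - x))"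
      using trans[of x] k0 by (intro integrableI_nonneg) auto
    have k1: "(LINT y|lborel. k (y - x)) = 1"
      using trans[of x] k0 by (simp add: integral_eq_nn_integral)
    define m where "m = (LINT y|lborel. k (y - x) * norm (u y))"
    have m0: "m \<ge> 0" unfolding m_def using k0 by (intro integral_nonneg_AE AE_I2) auto
    have cm: "norm (correlate k u x) \<le> m"
      using integral_norm_bound[of lborel "\<lambda>y. k (y - x) *\<^sub>R u y"] k0 by (simp add: correlate_def m_def)
    have "m powr p = (LINT y|lborel. (m powr p - p * m powr (p - 1) * m) * k (y - x) + p * m powr (p - 1) * (k (y - x) * norm (u y)))"
      using i0 i1 by (simp add: k1 flip: m_def)
    also have "\<dots> \<le> (LINT y|lborel. k (y - x) * norm (u y) powr p)"
    proof (intro integral_mono ip Bochner_Integration.integrable_add integrable_mult_right i0 i1)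
      fix y
      have "k (y - x) * (m powr p + p * m powr (p - 1) * (norm (u y) - m)) \<le> k (y - x) * norm (u y) powr p"
        using k0 m0 by (intro mult_left_mono powr_above_tangent p) auto
      then show "(m powr p - p * m powr (p - 1) * m) * k (y - x) + p * m powr (p - 1) * (k (y - x) * norm (u y))
        \<le> k (y - x) * norm (u y) powr p" by (simp add: algebra_simps)
    qed
    finally have "norm (correlate k u x) powr p \<le> (LINT y|lborel. k (y - x) * norm (u y) powr p)"
      using cm p by (meson norm_ge_zero order_trans powr_mono2 zero_le_one)
    then have "ennreal (norm (correlate k u x) powr p) \<le> ennreal (LINT y|lborel. k (y - x) * norm (u y) powr p)"
      by (rule ennreal_leI)
    also have "\<dots> = (\<integral>\<^sup>+y. ennreal (k (y - x) * norm (u y) powr p) \<partial>lborel)"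
      using ip k0 by (subst nn_integral_eq_integral) auto
    finally show ?thesis using k0 by (simp add: ennreal_mult)
  qed
  have "(\<integral>\<^sup>+x. ennreal (norm (correlate k u x) powr p) \<partial>lborel)
     \<le> (\<integral>\<^sup>+x. (\<integral>\<^sup>+y. ennreal (k (y - x)) * ennreal (norm (u y) powr p) \<partial>lborel) \<partial>lborel)"
    by (intro nn_integral_mono jensen)
  also have "\<dots> = (\<integral>\<^sup>+y. (\<integral>\<^sup>+x. ennreal (k (y - x)) * ennreal (norm (u y) powr p) \<partial>lborel) \<partial>lborel)"
    by (rule lborel_pair.Fubini') measurable
  also have "\<dots> = (\<integral>\<^sup>+y. ennreal (norm (u y) powr p) \<partial>lborel)"
    by (subst nn_integral_multc) (auto simp: refl)
  finally show ?thesis .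
qed

lemma box_integrable_norm_diff: "set_integrable lborel (cbox a b) (\<lambda>y. norm (u y - q))"
proof -
  obtain r where r: "cbox a b \<subseteq> cball 0 r"
    using bounded_cbox[of a b] by (auto simp: bounded_iff subset_iff)
  have "set_integrable lborel (cbox a b) u"
    by (rule set_integrable_subset[OF local_int[of r]]) (use r in auto)
  moreover have "set_integrable lborel (cbox a b) (\<lambda>_. q)"
    unfolding set_integrable_def using emeasure_lborel_cbox_finite[of a b]
    by (intro integrable_scaleR_left integrable_real_indicator) auto
  ultimately show ?thesis
    by (intro set_integrable_norm set_integral_diff)
qed

text \<open>
  Apply the differentiation theorem for cubes to \<open>y \<mapsto> norm (u y - q)\<close> for \<open>q\<close> in a countable dense set.
  At a point that is good for all of them, a \<open>q\<close> near \<open>u x\<close> gives the estimate for \<open>u x\<close> itself.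
\<close>

lemma ae_lebesgue_point:
  "AE x in lborel. \<forall>e>0. \<exists>\<delta>>0. \<forall>h. 0 < h \<and> h < \<delta> \<longrightarrow>
     (LINT y:cbox x (x + h *\<^sub>R One)|lborel. norm (u y - u x)) \<le> e * h ^ DIM('a)"
proof -
  note box_int = box_integrable_norm_diff
  obtain D :: "'b set" where D: "countable D" "\<And>X. open X \<Longrightarrow> X \<noteq> {} \<Longrightarrow> \<exists>q\<in>D. q \<in> X"
    using countable_dense_setE by blast
  have "\<exists>N. negligible N \<and> (\<forall>x e. x \<notin> N \<longrightarrow> 0 < e \<longrightarrow> (\<exists>\<delta>>0. \<forall>h. 0 < h \<and> h < \<delta> \<longrightarrow>
      norm (integral (cbox x (x + h *\<^sub>R One)) (\<lambda>y. norm (u y - q)) /\<^sub>R h ^ DIM('a) - norm (u x - q)) < e))" for q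
    using integrable_ccontinuous_explicit[of "\<lambda>y. norm (u y - q)"] set_borel_integral_eq_integral(1)[OF box_int]
    by metis
  then obtain N where N: "\<And>q. negligible (N q)" "\<And>q x e. x \<notin> N q \<Longrightarrow> 0 < e \<Longrightarrow> \<exists>\<delta>>0. \<forall>h. 0 < h \<and> h < \<delta> \<longrightarrow>
      norm (integral (cbox x (x + h *\<^sub>R One)) (\<lambda>y. norm (u y - q)) /\<^sub>R h ^ DIM('a) - norm (u x - q)) < e"
    by metis
  have "negligible (\<Union>q\<in>D. N q)" using D(1) N(1) by (intro negligible_countable_Union) auto
  then have "(\<Union>q\<in>D. N q) \<in> null_sets lebesgue" by (simp add: negligible_iff_null_sets)
  then have "AE x in lborel. x \<notin> (\<Union>q\<in>D. N q)" by (simp only: AE_not_in flip: AE_completion_iff[where M=lborel])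
  then show ?thesis
  proof (rule eventually_mono, intro allI impI)
    fix x and e :: real assume x: "x \<notin> (\<Union>q\<in>D. N q)" and e: "e > 0"
    obtain q where q: "q \<in> D" "norm (u x - q) < e / 3"
      using D(2)[of "ball (u x) (e / 3)"] e by (auto simp: dist_norm)
    obtain \<delta> where \<delta>: "\<delta> > 0" "\<And>h. 0 < h \<Longrightarrow> h < \<delta> \<Longrightarrow>
      norm (integral (cbox x (x + h *\<^sub>R One)) (\<lambda>y. norm (u y - q)) /\<^sub>R h ^ DIM('a) - norm (u x - q)) < e / 3"
      using N(2)[of x q "e / 3"] x q(1) e by auto
    show "\<exists>\<delta>>0. \<forall>h. 0 < h \<and> h < \<delta> \<longrightarrow> (LINT y:cbox x (x + h *\<^sub>R One)|lborel. norm (u y - u x)) \<le> e * h ^ DIM('a)"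
    proof (intro exI[of _ \<delta>] conjI allI impI \<delta>(1))
      fix h :: real assume h: "0 < h \<and> h < \<delta>"
      let ?Q = "cbox x (x + h *\<^sub>R One)"
      have hd: "h ^ DIM('a) > 0" using h by simp
      have vol: "measure lborel ?Q = h ^ DIM('a)"
        using h by (simp add: measure_lborel_cbox_eq inner_add_left)
      have "integral ?Q (\<lambda>y. norm (u y - q)) / h ^ DIM('a) < 2 * e / 3"
      proof -
        have "\<bar>integral ?Q (\<lambda>y. norm (u y - q)) / h ^ DIM('a) - norm (u x - q)\<bar> < e / 3"
          using \<delta>(2)[of h] h by (simp only: divide_inverse mult.commute real_norm_def real_scaleR_def)
        then show ?thesis using q(2) by linarith
      qed
      then have A: "(LINT y:?Q|lborel. norm (u y - q)) \<le> 2 * e / 3 * h ^ DIM('a)"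
        using hd by (simp add: set_borel_integral_eq_integral(2)[OF box_int] divide_less_eq)
      have ci: "set_integrable lborel ?Q (\<lambda>_. norm (q - u x))"
        unfolding set_integrable_def using emeasure_lborel_cbox_finite[of x "x + h *\<^sub>R One"]
        by (intro integrable_scaleR_left integrable_real_indicator) auto
      have "(LINT y:?Q|lborel. norm (u y - u x)) \<le> (LINT y:?Q|lborel. norm (u y - q) + norm (q - u x))"
        by (intro set_integral_mono box_int set_integral_add ci) (metis diff_add_cancel add_diff_eq norm_triangle_ineq)
      also have "\<dots> = (LINT y:?Q|lborel. norm (u y - q)) + norm (q - u x) * h ^ DIM('a)"
        by (subst set_integral_add(2)[OF box_int ci]) (simp add: set_lebesgue_integral_def vol mult.commute)
      also have "\<dots> \<le> 2 * e / 3 * h ^ DIM('a) + e / 3 * h ^ DIM('a)"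
        using q(2) h by (intro add_mono A mult_right_mono) (auto simp: norm_minus_commute)
      also have "\<dots> = e * h ^ DIM('a)" by (simp add: field_simps)
      finally show "(LINT y:?Q|lborel. norm (u y - u x)) \<le> e * h ^ DIM('a)" .
    qed
  qed
qed

end

section \<open>Exchange of coordinates\<close>

lemma Basis_cart_real: "Basis = range (\<lambda>k::'n::finite. axis k (1::real))"
  by (auto simp: Basis_vec_def)

lemma prod_Basis_cart_real:
  fixes v :: "real^'n::finite"
  shows "(\<Prod>b\<in>Basis. v \<bullet> b) = (\<Prod>k\<in>UNIV. v $ k)"
proof -
  have "inj (\<lambda>k::'n. axis k (1::real))" by (auto simp: inj_def axis_eq_axis)
  then show ?thesis by (simp add: Basis_cart_real prod.reindex inner_axis)
qed

lemma continuous_swap_coords: "continuous_on UNIV (swap_coords i j)"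
  unfolding swap_coords_def by (intro continuous_on_vec_lambda continuous_intros)

lemma borel_swap_coords [measurable]: "swap_coords i j \<in> borel_measurable borel"
  using continuous_swap_coords by (rule borel_measurable_continuous_onI)

lemma prod_swap_coords: "(\<Prod>k\<in>UNIV. swap_coords i j v $ k) = (\<Prod>k\<in>UNIV. v $ k)"
  using prod.reindex_bij_betw[of "Transposition.transpose i j" UNIV UNIV "\<lambda>k. v $ k"]
  by (simp add: swap_coords_def)

text \<open>
  Exchanging two coordinates maps boxes to boxes with the same side lengths in another order.
\<close>

lemma lborel_distr_swap_coords: "distr lborel borel (swap_coords i j) = (lborel :: (real^'n::finite) measure)"
proof (rule lborel_eqI[symmetric])
  fix l u :: "real^'n" assume lu: "\<And>b. b \<in> Basis \<Longrightarrow> l \<bullet> b \<le> u \<bullet> b"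
  have lu': "l $ k \<le> u $ k" for k using lu[of "axis k 1"] by (simp add: Basis_cart_real inner_axis)
  have pre: "swap_coords i j -` box l u = box (swap_coords i j l) (swap_coords i j u)"
  proof -
    have "(\<forall>k. l $ k < x $ Transposition.transpose i j k \<and> x $ Transposition.transpose i j k < u $ k) \<longleftrightarrow>
      (\<forall>k. l $ Transposition.transpose i j k < x $ k \<and> x $ k < u $ Transposition.transpose i j k)" for x :: "real^'n"
      by (metis transpose_involutory)
    then show ?thesis by (auto simp: mem_box_cart swap_coords_def)
  qed
  have "emeasure (distr lborel borel (swap_coords i j)) (box l u) = emeasure lborel (box (swap_coords i j l) (swap_coords i j u))"
    by (subst emeasure_distr) (auto simp: pre)
  also have "\<dots> = ennreal (\<Prod>b\<in>Basis. (swap_coords i j u - swap_coords i j l) \<bullet> b)"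
    by (rule emeasure_lborel_box) (auto simp: Basis_cart_real inner_axis swap_coords_def lu')
  also have "swap_coords i j u - swap_coords i j l = swap_coords i j (u - l)"
    by (simp add: swap_coords_def vec_eq_iff)
  also have "(\<Prod>b\<in>Basis. swap_coords i j (u - l) \<bullet> b) = (\<Prod>b\<in>Basis. (u - l) \<bullet> b)"
    by (simp only: prod_Basis_cart_real prod_swap_coords)
  finally show "emeasure (distr lborel borel (swap_coords i j)) (box l u) = ennreal (\<Prod>b\<in>Basis. (u - l) \<bullet> b)" .
qed simp

lemma correlate_swap_coords:
  fixes u :: "real^'n::finite \<Rightarrow> 'b::euclidean_space"
  assumes [measurable]: "k \<in> borel_measurable borel" "u \<in> borel_measurable borel"
    and k: "\<And>z. k (swap_coords i j z) = k z"
    and u: "AE y in lborel. u (swap_coords i j y) = - u y"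
  shows "correlate k u (swap_coords i j x) = - correlate k u x"
proof -
  have sd: "swap_coords i j y - swap_coords i j x = swap_coords i j (y - x)" for y
    by (simp add: swap_coords_def vec_eq_iff)
  have "correlate k u (swap_coords i j x) = (LINT y|distr lborel borel (swap_coords i j). k (y - swap_coords i j x) *\<^sub>R u y)"
    by (simp add: correlate_def lborel_distr_swap_coords)
  also have "\<dots> = (LINT y|lborel. k (swap_coords i j y - swap_coords i j x) *\<^sub>R u (swap_coords i j y))"
    by (subst integral_distr) auto
  also have "\<dots> = (LINT y|lborel. - (k (y - x) *\<^sub>R u y))"
    by (rule integral_cong_AE) (use u in \<open>auto simp: sd k\<close>)
  finally show ?thesis by (simp add: correlate_def)
qed

section \<open>Test functions and the mollifying kernel\<close>

lemma test_function_partials: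
  assumes "\<phi> \<in> test_functions"
  shows "continuous_on UNIV \<phi>" "continuous_on UNIV (partial i \<phi>)"
    and "(\<phi> has_derivative frechet_derivative \<phi> (at z)) (at z)"
    and "((\<lambda>s. \<phi> (z + s *\<^sub>R axis i 1)) has_real_derivative partial i \<phi> z) (at 0)"
proof -
  have C: "C_k k \<phi>" for k using assms by (simp add: test_functions_def)
  show "continuous_on UNIV \<phi>" using C[of 0] by simp
  show "continuous_on UNIV (partial i \<phi>)" using C[of "Suc 0"] by simp
  show D: "(\<phi> has_derivative frechet_derivative \<phi> (at z)) (at z)"
    using C[of "Suc 0"] by (simp add: frechet_derivative_works)
  have "((\<lambda>s::real. z + s *\<^sub>R axis i 1) has_derivative (\<lambda>s. s *\<^sub>R axis i 1)) (at 0)"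
    by (auto intro!: derivative_eq_intros)
  moreover have "(\<phi> has_derivative frechet_derivative \<phi> (at z)) (at (z + 0 *\<^sub>R axis i 1))" using D by simp
  ultimately have "((\<lambda>s. \<phi> (z + s *\<^sub>R axis i 1)) has_derivative (\<lambda>s. frechet_derivative \<phi> (at z) (s *\<^sub>R axis i 1))) (at 0)"
    by (rule has_derivative_compose)
  moreover have "frechet_derivative \<phi> (at z) (s *\<^sub>R axis i 1) = partial i \<phi> z * s" for s
    using linear_cmul[OF has_derivative_linear[OF D], of s "axis i 1"] by (simp add: partial_def)
  ultimately show "((\<lambda>s. \<phi> (z + s *\<^sub>R axis i 1)) has_real_derivative partial i \<phi> z) (at 0)"
    by (simp add: has_field_derivative_def)
qed

lemma partial_translate:
  assumes "\<And>z. \<phi> differentiable at z"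
  shows "partial i (\<lambda>y. \<phi> (y - x)) y = partial i \<phi> (y - x)"
proof -
  have "(\<phi> has_derivative frechet_derivative \<phi> (at (y - x))) (at (y - x))"
    using assms by (simp add: frechet_derivative_works)
  moreover have "((\<lambda>y. y - x) has_derivative (\<lambda>h. h)) (at y)" by (auto intro!: derivative_eq_intros)
  ultimately have "((\<lambda>y. \<phi> (y - x)) has_derivative frechet_derivative \<phi> (at (y - x))) (at y)"
    by (rule has_derivative_compose[rotated])
  then show ?thesis by (simp add: partial_def flip: frechet_derivative_at)
qed

lemma partial_eq_0_outside_ball:
  fixes \<phi> :: "real^'n::finite \<Rightarrow> real"
  assumes "\<And>z. norm z > r \<Longrightarrow> \<phi> z = 0" "norm z > r"
  shows "partial i \<phi> z = 0"
proof -
  have "((\<lambda>_. 0) has_derivative (\<lambda>_. 0)) (at z)" by simp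
  then have "(\<phi> has_derivative (\<lambda>_. 0)) (at z)"
    by (rule has_derivative_transform_within_open[where s="{z. r < norm z}"])
      (use assms in \<open>auto intro!: open_Collect_less continuous_intros\<close>)
  then show ?thesis by (simp add: partial_def flip: frechet_derivative_at)
qed

text \<open>
  The support has side \<open>1 / c\<close>; scaling multiplies the integral of the bump by \<open>c ^ (- d)\<close>, so that
  the constant factor normalises the integral to 1.
\<close>

definition cube_kernel :: "real \<Rightarrow> real^'n::finite \<Rightarrow> real" where
  "cube_kernel c z = c ^ CARD('n) / (LINT y|lborel. cube_bump 1 (y::real^'n)) * cube_bump c z"

lemma cube_bump_swap_coords: "cube_bump c (swap_coords i j z) = cube_bump c z"
  using prod.reindex_bij_betw[of "Transposition.transpose i j" UNIV UNIV "\<lambda>k. bump (c * z $ k)"]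
  by (simp add: cube_bump_def swap_coords_def)

lemma continuous_cube_bump: "c > 0 \<Longrightarrow> continuous_on UNIV (cube_bump c :: real^'n::finite \<Rightarrow> real)"
  using test_function_partials(1)[OF translated_cube_bump_test_function[of c 0]] by simp

lemma integrable_cube_bump:
  assumes "c > 0"
  shows "integrable lborel (cube_bump c :: real^'n::finite \<Rightarrow> real)"
proof (rule Bochner_Integration.integrable_bound)
  show "integrable lborel (indicat_real (cbox 0 (\<chi> i::'n. 1 / c)))"
    using emeasure_lborel_cbox_finite[of 0 "\<chi> i::'n. 1 / c"] by (intro integrable_real_indicator) auto
  show "cube_bump c \<in> borel_measurable (lborel :: (real^'n) measure)"
    using continuous_cube_bump[OF assms] by (auto intro: borel_measurable_continuous_onI)
  show "AE z in lborel. norm (cube_bump c z) \<le> norm (indicat_real (cbox 0 (\<chi> i::'n. 1 / c)) z)"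
  proof (rule AE_I2)
    fix z :: "real^'n"
    show "norm (cube_bump c z) \<le> norm (indicat_real (cbox 0 (\<chi> i::'n. 1 / c)) z)"
      using cube_bump_support[OF assms, of z] cube_bump_nonneg[of c z] cube_bump_le_1[of c z]
      by (cases "cube_bump c z = 0") auto
  qed
qed

lemma integral_cube_bump_pos: "(LINT y|lborel. cube_bump 1 (y::real^'n::finite)) > 0"
proof (rule ccontr)
  assume "\<not> ?thesis"
  moreover have "(LINT y|lborel. cube_bump 1 (y::real^'n)) \<ge> 0"
    by (intro integral_nonneg_AE AE_I2 cube_bump_nonneg)
  ultimately have "(LINT y|lborel. cube_bump 1 (y::real^'n)) = 0" by simp
  then have "AE y in lborel. cube_bump 1 (y::real^'n) = 0"
    by (subst (asm) integral_nonneg_eq_0_iff_AE) (auto simp: cube_bump_nonneg integrable_cube_bump)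
  then have "AE y in lborel. y \<notin> box (0::real^'n) (\<chi> i. 1)"
  proof (rule eventually_mono)
    fix y :: "real^'n" assume "cube_bump 1 y = 0"
    then obtain k where "bump (y $ k) = 0" by (auto simp: cube_bump_def)
    then show "y \<notin> box 0 (\<chi> i. 1)" using bump_pos[of "y $ k"] by (force simp: mem_box_cart)
  qed
  then have "emeasure lborel (box (0::real^'n) (\<chi> i. 1)) = 0"
    by (subst (asm) AE_iff_measurable[OF _ refl]) auto
  moreover have "emeasure lborel (box (0::real^'n) (\<chi> i. 1)) = ennreal (\<Prod>b\<in>Basis. ((\<chi> i. 1) - (0::real^'n)) \<bullet> b)"
    by (rule emeasure_lborel_box) (auto simp: Basis_cart_real inner_axis)
  ultimately show False by (simp add: prod_Basis_cart_real)
qed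

lemma cube_kernel_nonneg: "c > 0 \<Longrightarrow> cube_kernel c z \<ge> 0"
  using integral_cube_bump_pos by (auto simp: cube_kernel_def cube_bump_nonneg less_imp_le)

lemma continuous_cube_kernel: "c > 0 \<Longrightarrow> continuous_on UNIV (cube_kernel c :: real^'n::finite \<Rightarrow> real)"
  unfolding cube_kernel_def by (intro continuous_intros continuous_cube_bump)

lemma borel_cube_kernel: "c > 0 \<Longrightarrow> cube_kernel c \<in> borel_measurable borel"
  using continuous_cube_kernel by (rule borel_measurable_continuous_onI)

lemma nn_integral_cube_kernel:
  assumes "c > 0"
  shows "(\<integral>\<^sup>+z. ennreal (cube_kernel c (z::real^'n::finite)) \<partial>lborel) = 1"
proof -
  define B where "B = (LINT y|lborel. cube_bump 1 (y::real^'n))"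
  have B: "B > 0" unfolding B_def by (rule integral_cube_bump_pos)
  have int: "integrable lborel (cube_kernel c :: real^'n \<Rightarrow> real)"
    unfolding cube_kernel_def by (intro integrable_mult_right integrable_cube_bump assms)
  have "(LINT z|lborel. cube_bump c (z::real^'n)) = (LINT z|lborel. cube_bump 1 (c *\<^sub>R (z::real^'n)))"
    by (simp add: cube_bump_def)
  also have "\<dots> = B / c ^ CARD('n)"
    unfolding B_def
    by (subst lborel_integral_scale[OF assms borel_measurable_continuous_onI[OF continuous_cube_bump]]) auto
  finally have "(LINT z|lborel. cube_kernel c (z::real^'n)) = 1"
    using B assms by (simp add: cube_kernel_def flip: B_def)
  then show ?thesis
    using int cube_kernel_nonneg[OF assms] by (subst nn_integral_eq_integral) auto
qed

lemma cube_kernel_support: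
  fixes z :: "real^'n::finite"
  assumes "c > 0" "norm z > norm ((\<chi> i. 1 / c)::real^'n)"
  shows "cube_kernel c z = 0"
proof (rule ccontr)
  assume "cube_kernel c z \<noteq> 0"
  then have "cube_bump c z \<noteq> 0" by (auto simp: cube_kernel_def)
  then have "z \<in> cbox 0 (\<chi> i. 1 / c)" by (rule cube_bump_support[OF assms(1)])
  then have "norm z \<le> norm ((\<chi> i. 1 / c)::real^'n)"
    using assms(1) by (intro norm_le_componentwise_cart) (auto simp: mem_box_cart)
  with assms(2) show False by simp
qed

lemma C_k_cmult: "C_k k f \<Longrightarrow> C_k k (\<lambda>x. a * f x)"
proof (induction k arbitrary: f)
  case 0
  then show ?case by (simp add: continuous_on_mult_left)
next
  case (Suc k)
  have "partial i (\<lambda>x. a * f x) = (\<lambda>x. a * partial i f x)" for i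
  proof
    fix x
    have "(f has_derivative frechet_derivative f (at x)) (at x)"
      using Suc.prems by (simp add: frechet_derivative_works)
    then have "((\<lambda>x. a * f x) has_derivative (\<lambda>h. a * frechet_derivative f (at x) h)) (at x)"
      by (rule has_derivative_mult_right)
    then show "partial i (\<lambda>x. a * f x) x = a * partial i f x"
      by (simp add: partial_def flip: frechet_derivative_at)
  qed
  then show ?case using Suc by (auto intro: differentiable_mult)
qed

lemma translated_cube_kernel_test_function:
  fixes x :: "real^'n::finite"
  assumes "c > 0"
  shows "(\<lambda>y. cube_kernel c (y - x)) \<in> test_functions"
proof -
  have "{y. cube_kernel c (y - x) \<noteq> 0} = {y. cube_bump c (y - x) \<noteq> 0}"
    using assms integral_cube_bump_pos[where 'n='n] by (simp add: cube_kernel_def)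
  moreover have "C_k k (\<lambda>y. cube_kernel c (y - x))" for k
    unfolding cube_kernel_def
    by (rule C_k_cmult) (use translated_cube_bump_test_function[OF assms, of x] in \<open>simp add: test_functions_def\<close>)
  ultimately show ?thesis
    using translated_cube_bump_test_function[OF assms, of x] by (simp add: test_functions_def)
qed

lemma abs_cube_kernel_le:
  fixes z :: "real^'n::finite"
  assumes "c > 0"
  shows "\<bar>cube_kernel c z\<bar> \<le> c ^ CARD('n) / (LINT y|lborel. cube_bump 1 (y::real^'n))"
proof -
  define a where "a = c ^ CARD('n) / (LINT y|lborel. cube_bump 1 (y::real^'n))"
  have "a \<ge> 0" using assms integral_cube_bump_pos[where 'n='n] by (simp add: a_def)
  then have "a * cube_bump c z \<le> a" using mult_left_mono[OF cube_bump_le_1[of c z]] by fastforce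
  then show ?thesis
    using cube_kernel_nonneg[OF assms, of z] by (simp add: cube_kernel_def a_def)
qed

text \<open>
  The kernel is at most a constant times \<open>c ^ d\<close> on a cube of volume \<open>c ^ (- d)\<close> anchored at \<open>x\<close>, so
  the averages converge at every Lebesgue point.
\<close>

lemma correlate_cube_kernel_tendsto:
  fixes u :: "real^'n::finite \<Rightarrow> 'b::euclidean_space"
  assumes "mollification u"
  shows "AE x in lborel. (\<lambda>n. correlate (cube_kernel (real (Suc n))) u x) \<longlonglongrightarrow> u x"
proof -
  interpret mollification u by fact
  define B where "B = (LINT y|lborel. cube_bump 1 (y::real^'n))"
  have B: "B > 0" unfolding B_def by (rule integral_cube_bump_pos)
  show ?thesis
    using ae_lebesgue_point
  proof (rule eventually_mono)
    fix x :: "real^'n"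
    assume x: "\<forall>e>0. \<exists>\<delta>>0. \<forall>h. 0 < h \<and> h < \<delta> \<longrightarrow>
     (LINT y:cbox x (x + h *\<^sub>R One)|lborel. norm (u y - u x)) \<le> e * h ^ DIM(real^'n)"
    show "(\<lambda>n. correlate (cube_kernel (real (Suc n))) u x) \<longlonglongrightarrow> u x"
    proof (rule metric_LIMSEQ_I)
      fix e :: real assume e: "e > 0"
      obtain \<delta> where \<delta>: "\<delta> > 0" "\<And>h. 0 < h \<Longrightarrow> h < \<delta> \<Longrightarrow>
        (LINT y:cbox x (x + h *\<^sub>R One)|lborel. norm (u y - u x)) \<le> (e * B / 2) * h ^ CARD('n)"
        using x[rule_format, of "e * B / 2"] e B by auto
      obtain n0 where n0: "inverse (real (Suc n0)) < \<delta>" using reals_Archimedean[OF \<delta>(1)] by blast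
      show "\<exists>n0. \<forall>n\<ge>n0. dist (correlate (cube_kernel (real (Suc n))) u x) (u x) < e"
      proof (intro exI allI impI)
        fix n assume n: "n \<ge> n0"
        define c where "c = real (Suc n)"
        have c: "c > 0" by (simp add: c_def)
        define h where "h = 1 / c"
        have h: "h > 0" "h < \<delta>"
        proof -
          have "h \<le> inverse (real (Suc n0))" using n by (simp add: h_def c_def divide_inverse)
          then show "h < \<delta>" using n0 by simp
        qed (use c in \<open>simp add: h_def\<close>)
        let ?Q = "cbox x (x + h *\<^sub>R One)"
        let ?k = "cube_kernel c :: real^'n \<Rightarrow> real"
        have hOne: "h *\<^sub>R One = (\<chi> i::'n. 1 / c)"
        proof -
          have "One $ i = (1::real)" for i :: 'n
          proof -
            have "One $ i = One \<bullet> axis i (1::real)" by (simp add: inner_axis)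
            also have "\<dots> = 1" by (rule inner_sum_Basis) (auto simp: Basis_vec_def)
            finally show ?thesis .
          qed
          then show ?thesis by (simp add: vec_eq_iff h_def)
        qed
        have [measurable]: "?k \<in> borel_measurable borel" using borel_cube_kernel[OF c] .
        have k_abs: "\<bar>?k z\<bar> \<le> c ^ CARD('n) / B" for z
          unfolding B_def by (rule abs_cube_kernel_le[OF c])
        have i1: "integrable lborel (\<lambda>y. ?k (y - x) *\<^sub>R u y)"
          by (rule integrable_kernel[OF _ cube_kernel_support[OF c] k_abs]) auto
        have i0: "integrable lborel ?k"
          using nn_integral_cube_kernel[OF c, where 'n='n] cube_kernel_nonneg[OF c] by (intro integrableI_nonneg) auto
        have k1: "(LINT z|lborel. ?k z) = 1"
          using nn_integral_cube_kernel[OF c, where 'n='n] cube_kernel_nonneg[OF c]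
          by (subst integral_eq_nn_integral) auto
        have i0': "integrable lborel (\<lambda>y. ?k (y - x))" "(LINT y|lborel. ?k (y - x)) = 1"
          using lborel_integral_translate[of ?k "- x"] i0 k1 by simp_all
        have "correlate ?k u x - u x = (LINT y|lborel. ?k (y - x) *\<^sub>R u y - ?k (y - x) *\<^sub>R u x)"
          using i1 i0' by (simp add: correlate_def)
        then have "norm (correlate ?k u x - u x) = norm (LINT y|lborel. ?k (y - x) *\<^sub>R (u y - u x))"
          by (simp add: scaleR_diff_right)
        also have "\<dots> \<le> (LINT y|lborel. norm (?k (y - x) *\<^sub>R (u y - u x)))"
          by (rule integral_norm_bound)
        also have "\<dots> \<le> (LINT y|lborel. c ^ CARD('n) / B * (indicator ?Q y *\<^sub>R norm (u y - u x)))"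
        proof (rule integral_mono)
          show "integrable lborel (\<lambda>y. norm (?k (y - x) *\<^sub>R (u y - u x)))"
            using i1 i0' by (simp add: scaleR_diff_right)
          have "set_integrable lborel ?Q (\<lambda>y. norm (u y - u x))"
            by (rule box_integrable_norm_diff)
          then show "integrable lborel (\<lambda>y. c ^ CARD('n) / B * (indicator ?Q y *\<^sub>R norm (u y - u x)))"
            unfolding set_integrable_def by (rule integrable_mult_right)
          fix y
          show "norm (?k (y - x) *\<^sub>R (u y - u x)) \<le> c ^ CARD('n) / B * (indicator ?Q y *\<^sub>R norm (u y - u x))"
          proof (cases "y \<in> ?Q")
            case True
            then show ?thesis using mult_right_mono[OF k_abs, of "norm (u y - u x)" "y - x"] by simp
          next
            case False
            have "y - x \<notin> cbox 0 (\<chi> i. 1 / c)"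
              using False unfolding hOne by (auto simp: mem_box_cart algebra_simps)
            then have "cube_bump c (y - x) = 0" using cube_bump_support[OF c] by blast
            then show ?thesis using False by (simp add: cube_kernel_def)
          qed
        qed
        also have "\<dots> = c ^ CARD('n) / B * (LINT y:?Q|lborel. norm (u y - u x))"
          by (simp add: set_lebesgue_integral_def)
        also have "\<dots> \<le> c ^ CARD('n) / B * ((e * B / 2) * h ^ CARD('n))"
          using B c by (intro mult_left_mono \<delta>(2) h) auto
        also have "\<dots> = e / 2" using B c by (simp add: h_def power_divide)
        also have "\<dots> < e" using e by simp
        finally show "dist (correlate (cube_kernel (real (Suc n))) u x) (u x) < e"
          by (simp add: dist_norm c_def)
      qed
    qed
  qed
qed

section \<open>A radial cutoff\<close>

lemma square_pos_part_has_derivative: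
  fixes s :: real
  shows "((\<lambda>s. (max 0 s)\<^sup>2) has_real_derivative 2 * max 0 s) (at s)"
proof (cases s "0::real" rule: linorder_cases)
  case less
  have "((\<lambda>_. 0) has_real_derivative 0) (at s)" by simp
  then have "((\<lambda>s. (max 0 s)\<^sup>2) has_real_derivative 0) (at s)"
    by (rule has_field_derivative_transform_within_open[where S="{..<0}"]) (use less in auto)
  then show ?thesis using less by simp
next
  case greater
  have "((\<lambda>s. s\<^sup>2) has_real_derivative 2 * s) (at s)" by (auto intro!: derivative_eq_intros)
  then have "((\<lambda>s. (max 0 s)\<^sup>2) has_real_derivative 2 * s) (at s)"
    by (rule has_field_derivative_transform_within_open[where S="{0<..}"]) (use greater in auto)
  then show ?thesis using greater by simp
next
  case equal
  have "((\<lambda>h::real. max 0 h * (max 0 h / h)) \<longlongrightarrow> 0) (at 0)"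
  proof (rule Lim_null_comparison[where g="\<lambda>h. \<bar>h\<bar>"])
    show "\<forall>\<^sub>F h in at 0. norm (max 0 h * (max 0 h / h)) \<le> \<bar>h::real\<bar>"
      by (intro always_eventually allI) (auto simp: max_def)
    show "((\<lambda>h::real. \<bar>h\<bar>) \<longlongrightarrow> 0) (at 0)"
      using tendsto_rabs[OF tendsto_ident_at[of "0::real" UNIV]] by simp
  qed
  then have "((\<lambda>h::real. ((max 0 (0 + h))\<^sup>2 - (max 0 0)\<^sup>2) / h) \<longlongrightarrow> 0) (at 0)"
    by (simp add: power2_eq_square)
  then show ?thesis using equal by (simp add: DERIV_def)
qed

text \<open>
  A continuously differentiable radial cutoff. It need not equal 1 near the origin: it suffices that
  it increases to 1 pointwise as \<open>R\<close> grows and that its gradient is at most \<open>4 / R\<close>.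
\<close>

definition cutoff :: "real \<Rightarrow> real^'n::finite \<Rightarrow> real" where
  "cutoff R x = (max 0 (1 - (norm x)\<^sup>2 / R\<^sup>2))\<^sup>2"

definition cutoff_partial :: "real \<Rightarrow> real^'n::finite \<Rightarrow> 'n \<Rightarrow> real" where
  "cutoff_partial R x i = - (4 * max 0 (1 - (norm x)\<^sup>2 / R\<^sup>2) * x $ i / R\<^sup>2)"

lemma cutoff_has_partial:
  assumes "R > 0"
  shows "((\<lambda>s. cutoff R (x + s *\<^sub>R axis i 1)) has_real_derivative cutoff_partial R x i) (at 0)"
proof -
  have "((\<lambda>s. 1 - (norm (x + s *\<^sub>R axis i 1))\<^sup>2 / R\<^sup>2) has_real_derivative - (2 * x $ i / R\<^sup>2)) (at 0)"
    unfolding norm_axis_line_squared using assms by (auto intro!: derivative_eq_intros simp: field_simps eval_nat_numeral)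
  from DERIV_chain2[OF square_pos_part_has_derivative this]
  show ?thesis by (simp add: cutoff_def cutoff_partial_def mult.assoc)
qed

lemma cutoff_bounds: "0 \<le> cutoff R x" "cutoff R x \<le> 1"
  by (auto simp: cutoff_def power_le_one)

lemma cutoff_eq_0:
  assumes "R > 0" "norm x \<ge> R"
  shows "cutoff R x = 0" "cutoff_partial R x i = 0"
proof -
  have "R\<^sup>2 \<le> (norm x)\<^sup>2" using assms by (intro power_mono) auto
  then have "max 0 (1 - (norm x)\<^sup>2 / R\<^sup>2) = 0" using assms(1) by (simp add: max_def)
  then show "cutoff R x = 0" "cutoff_partial R x i = 0" by (simp_all add: cutoff_def cutoff_partial_def)
qed

lemma norm_cutoff_gradient_le:
  assumes "R > 0"
  shows "norm (\<chi> i. cutoff_partial R x i *\<^sub>R w) \<le> 4 / R * norm w"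
proof (cases "norm x \<ge> R")
  case True
  then show ?thesis using cutoff_eq_0(2)[OF assms True] assms by (simp add: norm_vec_def L2_set_def)
next
  case False
  define m where "m = max 0 (1 - (norm x)\<^sup>2 / R\<^sup>2)"
  have m: "0 \<le> m" "m \<le> 1" by (auto simp: m_def)
  have "norm (cutoff_partial R x i *\<^sub>R w) = (4 * m / R\<^sup>2 * norm w) * \<bar>x $ i\<bar>" for i
    using m by (simp add: cutoff_partial_def abs_mult flip: m_def)
  then have "norm (\<chi> i. cutoff_partial R x i *\<^sub>R w) = L2_set (\<lambda>i. (4 * m / R\<^sup>2 * norm w) * norm (x $ i)) UNIV"
    by (simp only: norm_vec_def[of "\<chi> i. _ i"] vec_lambda_beta real_norm_def)
  also have "\<dots> = (4 * m / R\<^sup>2 * norm w) * norm x"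
    unfolding norm_vec_def[of x] using m by (intro L2_set_right_distrib[symmetric]) auto
  finally have "norm (\<chi> i. cutoff_partial R x i *\<^sub>R w) = (4 * m / R\<^sup>2 * norm w) * norm x" .
  also have "\<dots> \<le> (4 * 1 / R\<^sup>2 * norm w) * R"
    using m False by (intro mult_mono divide_right_mono) auto
  also have "\<dots> = 4 / R * norm w" using assms by (simp add: power2_eq_square)
  finally show ?thesis .
qed

lemma continuous_cutoff: "R > 0 \<Longrightarrow> continuous_on UNIV (cutoff R)"
  unfolding cutoff_def by (intro continuous_intros) auto

lemma continuous_cutoff_partial: "R > 0 \<Longrightarrow> continuous_on UNIV (\<lambda>x. cutoff_partial R x i)"
  unfolding cutoff_partial_def by (intro continuous_intros) auto

lemma cutoff_swap_coords: "cutoff R (swap_coords i j x) = cutoff R x"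
proof -
  have "(\<Sum>k\<in>UNIV. (norm (swap_coords i j x $ k))\<^sup>2) = (\<Sum>k\<in>UNIV. (norm (x $ k))\<^sup>2)"
    using sum.reindex_bij_betw[of "Transposition.transpose i j" UNIV UNIV "\<lambda>k. (norm (x $ k))\<^sup>2"]
    by (simp add: swap_coords_def)
  then have "norm (swap_coords i j x) = norm x" by (simp add: norm_vec_def L2_set_def)
  then show ?thesis by (simp add: cutoff_def)
qed

lemma cutoff_tendsto_1: "(\<lambda>n. cutoff (real (Suc n)) x) \<longlonglongrightarrow> 1"
proof -
  have "(\<lambda>n. norm x * inverse (real (Suc n))) \<longlonglongrightarrow> norm x * 0"
    by (intro tendsto_mult tendsto_const LIMSEQ_inverse_real_of_nat)
  then have "(\<lambda>n. (max 0 (1 - (norm x * inverse (real (Suc n)))\<^sup>2))\<^sup>2) \<longlonglongrightarrow> (max 0 (1 - (norm x * 0)\<^sup>2))\<^sup>2"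
    by (intro tendsto_power tendsto_max tendsto_diff tendsto_const)
  then show ?thesis by (simp add: cutoff_def power_mult_distrib divide_inverse power_inverse)
qed

section \<open>Approximation of weakly differentiable functions\<close>

lemma correlate_vec_nth:
  fixes g :: "real^'n::finite \<Rightarrow> 'b::euclidean_space^'m::finite"
  assumes "integrable lborel (\<lambda>y. k (y - x) *\<^sub>R g y)"
  shows "correlate k g x $ i = (LINT y|lborel. k (y - x) *\<^sub>R (g y $ i))"
  unfolding correlate_def
  using integral_bounded_linear[OF bounded_linear_vec_nth assms, of i] by simp

text \<open>
  The weak gradient is tested against \<open>y \<mapsto> cube_kernel c (y - x)\<close>, which shows that the mollified
  \<open>g\<close> is the classical gradient of the mollified \<open>u\<close>. The kernel and the cutoff are invariant under
  permutations, so almost-everywhere antisymmetry of \<open>u\<close> becomes antisymmetry at every point.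
\<close>

lemma mollified_cutoff_smooth_antisymmetric:
  fixes u :: "real^'n::finite \<Rightarrow> 'b::euclidean_space" and g :: "real^'n \<Rightarrow> 'b^'n"
  assumes dim: "CARD('n) \<ge> 2"
    and u: "mollification u" and g: "mollification g"
    and weak: "\<And>\<phi> i. \<phi> \<in> test_functions \<Longrightarrow>
       (LINT y|lborel. partial i \<phi> y *\<^sub>R u y) = - (LINT y|lborel. \<phi> y *\<^sub>R (g y $ i))"
    and anti: "\<And>i j. i \<noteq> j \<Longrightarrow> AE y in lborel. u (swap_coords i j y) = - u y"
    and c: "c > 0" and R: "R > 0"
  shows "smooth_antisymmetric (\<lambda>x. cutoff R x *\<^sub>R correlate (cube_kernel c) u x)
     (\<lambda>x. cutoff R x *\<^sub>R correlate (cube_kernel c) g x + (\<chi> i. cutoff_partial R x i *\<^sub>R correlate (cube_kernel c) u x)) R"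
proof -
  interpret mu: mollification u by fact
  interpret mg: mollification g by fact
  let ?k = "cube_kernel c :: real^'n \<Rightarrow> real"
  define r where "r = norm ((\<chi> i. 1 / c) :: real^'n)"
  have supp: "?k z = 0" if "norm z > r" for z using cube_kernel_support[OF c] that by (simp add: r_def)
  have test: "(\<lambda>y. ?k (y - x)) \<in> test_functions" for x by (rule translated_cube_kernel_test_function[OF c])
  have test0: "?k \<in> test_functions" using test[of 0] by simp
  note kp = test_function_partials[OF test0]
  have supp': "partial i ?k z = 0" if "norm z > r" for z i
    using partial_eq_0_outside_ball[of r ?k z i] supp that by blast
  note M = abs_cube_kernel_le[OF c]
  have cont_u: "continuous_on UNIV (correlate ?k u)"
    by (rule mu.continuous_correlate[OF kp(1) supp M])
  have cont_g: "continuous_on UNIV (correlate ?k g)"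
    by (rule mg.continuous_correlate[OF kp(1) supp M])
  have deriv_u: "((\<lambda>s. correlate ?k u (x + s *\<^sub>R axis i 1)) has_vector_derivative correlate ?k g x $ i) (at 0)" for x i
  proof -
    obtain M' where M': "\<And>z. \<bar>partial i ?k z\<bar> \<le> M'"
      using bounded_if_zero_outside_ball[OF kp(2) supp'] by (metis real_norm_def)
    have "((\<lambda>s. correlate ?k u (x + s *\<^sub>R axis i 1)) has_vector_derivative - correlate (partial i ?k) u x) (at 0)"
      by (rule mu.correlate_has_directional_derivative[where r=r and M="max (c ^ CARD('n) / (LINT y|lborel. cube_bump 1 (y::real^'n))) M'", OF kp(1,2,4) supp _ supp'])
        (use order_trans[OF M max.cobounded1] order_trans[OF M' max.cobounded2] in auto)
    moreover have "- correlate (partial i ?k) u x = correlate ?k g x $ i"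
    proof -
      have diff: "?k differentiable at z" for z using kp(3) by (auto simp: differentiable_def)
      have "correlate (partial i ?k) u x = (LINT y|lborel. partial i (\<lambda>y. ?k (y - x)) y *\<^sub>R u y)"
        by (simp add: correlate_def partial_translate[OF diff])
      also have "\<dots> = - (LINT y|lborel. ?k (y - x) *\<^sub>R (g y $ i))" by (rule weak[OF test])
      also have "(LINT y|lborel. ?k (y - x) *\<^sub>R (g y $ i)) = correlate ?k g x $ i"
        using correlate_vec_nth[OF mg.integrable_kernel[OF borel_cube_kernel[OF c] supp M]] by simp
      finally show ?thesis by simp
    qed
    ultimately show ?thesis by simp
  qed
  show ?thesis
  proof
    show "2 \<le> CARD('n)" by fact
    show "continuous_on UNIV (\<lambda>x. cutoff R x *\<^sub>R correlate ?k u x)"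
      by (intro continuous_intros continuous_cutoff R cont_u)
    show "continuous_on UNIV (\<lambda>x. cutoff R x *\<^sub>R correlate ?k g x + (\<chi> i. cutoff_partial R x i *\<^sub>R correlate ?k u x))"
      by (intro continuous_intros continuous_on_vec_lambda continuous_cutoff continuous_cutoff_partial R cont_u cont_g)
    show "((\<lambda>s. cutoff R (x + s *\<^sub>R axis i 1) *\<^sub>R correlate ?k u (x + s *\<^sub>R axis i 1)) has_vector_derivative
        (cutoff R x *\<^sub>R correlate ?k g x + (\<chi> i. cutoff_partial R x i *\<^sub>R correlate ?k u x)) $ i) (at 0)" for x i
      using has_vector_derivative_scaleR[OF cutoff_has_partial[OF R] deriv_u, of x i] by simp
    show "cutoff R x *\<^sub>R correlate ?k u x = 0" if "R \<le> norm x" for x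
      using cutoff_eq_0(1)[OF R that] by simp
    show "cutoff R x *\<^sub>R correlate ?k g x + (\<chi> i. cutoff_partial R x i *\<^sub>R correlate ?k u x) = 0" if "R \<le> norm x" for x
      using cutoff_eq_0[OF R that] by (simp add: vec_eq_iff)
    show "cutoff R (swap_coords i j x) *\<^sub>R correlate ?k u (swap_coords i j x) = - (cutoff R x *\<^sub>R correlate ?k u x)"
      if "i \<noteq> j" for x i j
    proof -
      have "?k (swap_coords i j z) = ?k z" for z by (simp add: cube_kernel_def cube_bump_swap_coords)
      then show ?thesis
        by (simp add: cutoff_swap_coords correlate_swap_coords[OF borel_cube_kernel[OF c] mu.borel_u _ anti[OF that]])
    qed
  qed
qed

text \<open>
  Apply the smooth case to \<open>v n\<close>, the function mollified at scale \<open>1 / Suc n\<close> and cut off at radius \<open>Suc n\<close>.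
  On the side of \<open>u\<close>, Fatou's lemma needs only convergence almost everywhere. On the side of the
  gradient, Jensen bounds the mollified gradient, and the gradient of the cutoff contributes
  \<open>O(1 / Suc n)\<close>, separated from the main term by \<open>l\<close>. So \<open>n \<rightarrow> \<infinity>\<close> first, then \<open>l \<rightarrow> 0\<close>.
\<close>

lemma hardy_weak_gradient:
  fixes u :: "real^'n::finite \<Rightarrow> 'b::euclidean_space" and g :: "real^'n \<Rightarrow> 'b^'n" and p :: real
  assumes p: "p \<ge> 2" and dim: "CARD('n) \<ge> 2"
    and u: "mollification u" and g: "mollification g"
    and weak: "\<And>\<phi> i. \<phi> \<in> test_functions \<Longrightarrow>
       (LINT y|lborel. partial i \<phi> y *\<^sub>R u y) = - (LINT y|lborel. \<phi> y *\<^sub>R (g y $ i))"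
    and anti: "\<And>i j. i \<noteq> j \<Longrightarrow> AE y in lborel. u (swap_coords i j y) = - u y"
    and fin: "(\<integral>\<^sup>+x. ennreal (norm (u x) powr p) \<partial>lborel) < \<infinity>"
  shows "ennreal (C_H CARD('n) p) * (\<integral>\<^sup>+x. ennreal (norm (u x) powr p / norm x powr p) \<partial>lborel)
     \<le> (\<integral>\<^sup>+x. ennreal (norm (g x) powr p) \<partial>lborel)"
proof (cases "(\<integral>\<^sup>+x. ennreal (norm (g x) powr p) \<partial>lborel) = \<infinity>")
  case True
  then show ?thesis by simp
next
  case Gfin: False
  interpret mu: mollification u by fact
  interpret mg: mollification g by fact
  define G where "G = (\<integral>\<^sup>+x. ennreal (norm (g x) powr p) \<partial>lborel)"
  define U where "U = (\<integral>\<^sup>+x. ennreal (norm (u x) powr p) \<partial>lborel)"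
  let ?k = "\<lambda>n. cube_kernel (real (Suc n)) :: real^'n \<Rightarrow> real"
  let ?N = "\<lambda>n. real (Suc n)"
  define C where "C = C_H CARD('n) p"
  have C0: "C \<ge> 0" by (simp add: C_def C_H_def)
  define v where "v n x = cutoff (?N n) x *\<^sub>R correlate (?k n) u x" for n x
  define h where "h n x = cutoff (?N n) x *\<^sub>R correlate (?k n) g x + (\<chi> i. cutoff_partial (?N n) x i *\<^sub>R correlate (?k n) u x)" for n x
  have sm: "smooth_antisymmetric (v n) (h n) (?N n)" for n
    unfolding v_def h_def by (rule mollified_cutoff_smooth_antisymmetric[OF dim u g weak anti]) auto
  define F where "F n x = ennreal (C * (norm (v n x) powr p / norm x powr p))" for n x
  have [measurable]: "v n \<in> borel_measurable borel" for n
    by (intro borel_measurable_continuous_onI smooth_antisymmetric.v_cont[OF sm])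
  have N: "?N n > 0" for n by simp
  have kc: "continuous_on UNIV (?k n)" for n by (rule continuous_cube_kernel) simp
  have [measurable]: "correlate (?k n) u \<in> borel_measurable borel" for n
    by (rule borel_measurable_continuous_onI[OF mu.continuous_correlate[OF kc cube_kernel_support[OF N] abs_cube_kernel_le[OF N]]])
  have [measurable]: "correlate (?k n) g \<in> borel_measurable borel" for n
    by (rule borel_measurable_continuous_onI[OF mg.continuous_correlate[OF kc cube_kernel_support[OF N] abs_cube_kernel_le[OF N]]])
  have young: "(\<integral>\<^sup>+x. ennreal (norm (correlate (?k n) w x) powr p) \<partial>lborel) \<le> (\<integral>\<^sup>+x. ennreal (norm (w x) powr p) \<partial>lborel)"
    if w: "mollification w" for n and w :: "real^'n \<Rightarrow> 'c::euclidean_space"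
    by (rule mollification.nn_integral_correlate_powr_le[OF w _ borel_cube_kernel[OF N] cube_kernel_nonneg[OF N]
          nn_integral_cube_kernel[OF N] cube_kernel_support[OF N] order_trans[OF abs_ge_self abs_cube_kernel_le[OF N]]])
      (use p in auto)
  have F_split: "F n x = ennreal C * ennreal (norm (v n x) powr p / norm x powr p)" for n x
    unfolding F_def using C0 by (intro ennreal_mult) auto
  have bound: "(\<integral>\<^sup>+x. F n x \<partial>lborel) \<le> ennreal ((1 - l) powr (1 - p)) * G + ennreal (l powr (1 - p) * (4 / ?N n) powr p) * U"
    if l: "0 < l" "l < 1" for n l
  proof -
    have "(\<integral>\<^sup>+x. F n x \<partial>lborel) = ennreal C * (\<integral>\<^sup>+x. ennreal (norm (v n x) powr p / norm x powr p) \<partial>lborel)"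
      unfolding F_split by (rule nn_integral_cmult) measurable
    also have "\<dots> \<le> (\<integral>\<^sup>+x. ennreal (norm (h n x) powr p) \<partial>lborel)"
      unfolding C_def by (rule smooth_antisymmetric.hardy_smooth[OF sm p])
    also have "\<dots> \<le> (\<integral>\<^sup>+x. ennreal ((1 - l) powr (1 - p)) * ennreal (norm (correlate (?k n) g x) powr p)
        + ennreal (l powr (1 - p) * (4 / ?N n) powr p) * ennreal (norm (correlate (?k n) u x) powr p) \<partial>lborel)"
    proof (rule nn_integral_mono)
      fix x
      let ?a = "norm (correlate (?k n) g x)" and ?b = "4 / ?N n * norm (correlate (?k n) u x)"
      have "norm (h n x) \<le> norm (cutoff (?N n) x *\<^sub>R correlate (?k n) g x) + ?b"
        unfolding h_def by (intro order_trans[OF norm_triangle_ineq] add_left_mono norm_cutoff_gradient_le) simp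
      also have "norm (cutoff (?N n) x *\<^sub>R correlate (?k n) g x) \<le> ?a"
        using cutoff_bounds[of "?N n" x] by (simp add: mult_left_le_one_le)
      finally have "norm (h n x) \<le> ?a + ?b" by simp
      then have "norm (h n x) powr p \<le> (?a + ?b) powr p" using p by (intro powr_mono2) auto
      also have "\<dots> \<le> (1 - l) powr (1 - p) * ?a powr p + l powr (1 - p) * ?b powr p"
        using p l by (intro powr_add_le_weighted) auto
      also have "?b powr p = (4 / ?N n) powr p * norm (correlate (?k n) u x) powr p"
        by (rule powr_mult)
      finally have "norm (h n x) powr p \<le> (1 - l) powr (1 - p) * ?a powr p
          + (l powr (1 - p) * (4 / ?N n) powr p) * norm (correlate (?k n) u x) powr p" by (simp only: mult.assoc)
      then have "ennreal (norm (h n x) powr p) \<le> ennreal ((1 - l) powr (1 - p) * ?a powr p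
          + (l powr (1 - p) * (4 / ?N n) powr p) * norm (correlate (?k n) u x) powr p)" by (rule ennreal_leI)
      also have "\<dots> = ennreal ((1 - l) powr (1 - p)) * ennreal (?a powr p)
          + ennreal (l powr (1 - p) * (4 / ?N n) powr p) * ennreal (norm (correlate (?k n) u x) powr p)"
        by (subst ennreal_plus) (simp_all only: ennreal_mult powr_ge_zero mult_nonneg_nonneg)
      finally show "ennreal (norm (h n x) powr p) \<le> ennreal ((1 - l) powr (1 - p)) * ennreal (?a powr p)
          + ennreal (l powr (1 - p) * (4 / ?N n) powr p) * ennreal (norm (correlate (?k n) u x) powr p)" .
    qed
    also have "\<dots> = ennreal ((1 - l) powr (1 - p)) * (\<integral>\<^sup>+x. ennreal (norm (correlate (?k n) g x) powr p) \<partial>lborel)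
        + ennreal (l powr (1 - p) * (4 / ?N n) powr p) * (\<integral>\<^sup>+x. ennreal (norm (correlate (?k n) u x) powr p) \<partial>lborel)"
    proof -
      have m: "(\<lambda>x. ennreal (norm (correlate (?k n) g x) powr p)) \<in> borel_measurable lborel"
        "(\<lambda>x. ennreal (norm (correlate (?k n) u x) powr p)) \<in> borel_measurable lborel"
        by measurable
      have m': "(\<lambda>x. a * ennreal (norm (correlate (?k n) g x) powr p)) \<in> borel_measurable lborel"
        "(\<lambda>x. a * ennreal (norm (correlate (?k n) u x) powr p)) \<in> borel_measurable lborel" for a
        by measurable
      show ?thesis unfolding nn_integral_add[OF m'] nn_integral_cmult[OF m(1)] nn_integral_cmult[OF m(2)] ..
    qed
    also have "\<dots> \<le> ennreal ((1 - l) powr (1 - p)) * G + ennreal (l powr (1 - p) * (4 / ?N n) powr p) * U"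
      unfolding G_def U_def by (intro add_mono mult_left_mono young u g) auto
    finally show ?thesis .
  qed
  have ae: "AE x in lborel. (\<lambda>n. F n x) \<longlonglongrightarrow> ennreal (C * (norm (u x) powr p / norm x powr p))"
    using correlate_cube_kernel_tendsto[OF u]
  proof (rule eventually_mono)
    fix x assume "(\<lambda>n. correlate (?k n) u x) \<longlonglongrightarrow> u x"
    then have "(\<lambda>n. v n x) \<longlonglongrightarrow> 1 *\<^sub>R u x"
      unfolding v_def by (intro tendsto_scaleR cutoff_tendsto_1)
    then have "(\<lambda>n. norm (v n x)) \<longlonglongrightarrow> norm (u x)" by (intro tendsto_norm) simp
    then have "(\<lambda>n. norm (v n x) powr p) \<longlonglongrightarrow> norm (u x) powr p"
      using p by (intro tendsto_powr' tendsto_const) auto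
    then show "(\<lambda>n. F n x) \<longlonglongrightarrow> ennreal (C * (norm (u x) powr p / norm x powr p))"
      unfolding F_def divide_inverse by (intro tendsto_ennrealI tendsto_mult tendsto_const)
  qed
  have fatou: "ennreal C * (\<integral>\<^sup>+x. ennreal (norm (u x) powr p / norm x powr p) \<partial>lborel)
      \<le> liminf (\<lambda>n. \<integral>\<^sup>+x. F n x \<partial>lborel)"
  proof -
    have "ennreal C * (\<integral>\<^sup>+x. ennreal (norm (u x) powr p / norm x powr p) \<partial>lborel)
       = (\<integral>\<^sup>+x. ennreal (C * (norm (u x) powr p / norm x powr p)) \<partial>lborel)"
      by (subst ennreal_mult[OF C0]) (auto intro!: nn_integral_cmult[symmetric])
    also have "\<dots> = (\<integral>\<^sup>+x. liminf (\<lambda>n. F n x) \<partial>lborel)"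
      by (intro nn_integral_cong_AE eventually_mono[OF ae]) (simp add: lim_imp_Liminf)
    also have "\<dots> \<le> liminf (\<lambda>n. \<integral>\<^sup>+x. F n x \<partial>lborel)"
      unfolding F_def by (intro nn_integral_liminf) measurable
    finally show ?thesis .
  qed
  have step: "ennreal C * (\<integral>\<^sup>+x. ennreal (norm (u x) powr p / norm x powr p) \<partial>lborel) \<le> ennreal ((1 - l) powr (1 - p)) * G"
    if l: "0 < l" "l < 1" for l
  proof -
    have "(\<lambda>n. 4 * inverse (?N n)) \<longlonglongrightarrow> 4 * 0" by (intro tendsto_intros LIMSEQ_inverse_real_of_nat)
    then have "(\<lambda>n. (4 / ?N n) powr p) \<longlonglongrightarrow> 0 powr p"
      using p by (intro tendsto_powr' tendsto_const) (auto simp: divide_inverse)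
    then have "(\<lambda>n. l powr (1 - p) * (4 / ?N n) powr p) \<longlonglongrightarrow> l powr (1 - p) * 0"
      using p by (intro tendsto_mult tendsto_const) simp
    then have "(\<lambda>n. ennreal (l powr (1 - p) * (4 / ?N n) powr p) * U) \<longlonglongrightarrow> ennreal (l powr (1 - p) * 0) * U"
      using fin by (intro tendsto_mult_ennreal tendsto_ennrealI tendsto_const) (auto simp: U_def)
    then have "(\<lambda>n. ennreal ((1 - l) powr (1 - p)) * G + ennreal (l powr (1 - p) * (4 / ?N n) powr p) * U)
       \<longlonglongrightarrow> ennreal ((1 - l) powr (1 - p)) * G + 0"
      by (intro tendsto_add tendsto_const) simp
    then have "liminf (\<lambda>n. ennreal ((1 - l) powr (1 - p)) * G + ennreal (l powr (1 - p) * (4 / ?N n) powr p) * U)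
       = ennreal ((1 - l) powr (1 - p)) * G"
      by (simp add: lim_imp_Liminf)
    moreover have "liminf (\<lambda>n. \<integral>\<^sup>+x. F n x \<partial>lborel) \<le> liminf (\<lambda>n. ennreal ((1 - l) powr (1 - p)) * G + ennreal (l powr (1 - p) * (4 / ?N n) powr p) * U)"
      by (intro Liminf_mono always_eventually allI bound l)
    ultimately show ?thesis using fatou by simp
  qed
  have "(\<lambda>n. 1 - inverse (real (Suc (Suc n)))) \<longlonglongrightarrow> 1 - 0"
    using LIMSEQ_Suc[OF LIMSEQ_inverse_real_of_nat] by (intro tendsto_intros)
  then have "(\<lambda>n. (1 - inverse (real (Suc (Suc n)))) powr (1 - p)) \<longlonglongrightarrow> (1 - 0) powr (1 - p)"
    by (intro tendsto_powr tendsto_const) auto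
  then have "(\<lambda>n. ennreal ((1 - inverse (real (Suc (Suc n)))) powr (1 - p)) * G) \<longlonglongrightarrow> ennreal ((1 - 0) powr (1 - p)) * G"
    using Gfin by (intro tendsto_mult_ennreal tendsto_ennrealI tendsto_const) (auto simp: G_def)
  then have "(\<lambda>n. ennreal ((1 - inverse (real (Suc (Suc n)))) powr (1 - p)) * G) \<longlonglongrightarrow> G" by simp
  moreover have "ennreal C * (\<integral>\<^sup>+x. ennreal (norm (u x) powr p / norm x powr p) \<partial>lborel)
     \<le> ennreal ((1 - inverse (real (Suc (Suc n)))) powr (1 - p)) * G" for n
    by (rule step) (auto simp: inverse_eq_divide)
  ultimately have "ennreal C * (\<integral>\<^sup>+x. ennreal (norm (u x) powr p / norm x powr p) \<partial>lborel) \<le> G"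
    by (intro LIMSEQ_le_const) auto
  then show ?thesis by (simp add: G_def C_def)
qed

lemma lebesgue_ex_borel_version:
  fixes f :: "'a::euclidean_space \<Rightarrow> 'b::euclidean_space"
  assumes "f \<in> borel_measurable lebesgue"
  obtains f' where "f' \<in> borel_measurable borel" "AE x in lborel. f x = f' x"
proof -
  have "\<exists>f'\<in>borel_measurable lborel. AE x in lborel. f x \<bullet> b = f' x" for b
    by (intro completion_ex_borel_measurable_real borel_measurable_inner assms borel_measurable_const)
  then obtain F where F: "\<And>b. F b \<in> borel_measurable borel" "\<And>b. AE x in lborel. f x \<bullet> b = F b x"
    by simp metis
  have "(\<lambda>x. \<Sum>b\<in>Basis. F b x *\<^sub>R b) \<in> borel_measurable borel"
    using F(1) by measurable
  moreover have "AE x in lborel. \<forall>b\<in>Basis. f x \<bullet> b = F b x"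
    using F(2) by (intro AE_finite_allI) auto
  then have "AE x in lborel. f x = (\<Sum>b\<in>Basis. F b x *\<^sub>R b)"
  proof (rule eventually_mono)
    fix x assume "\<forall>b\<in>Basis. f x \<bullet> b = F b x"
    then show "f x = (\<Sum>b\<in>Basis. F b x *\<^sub>R b)" by (subst euclidean_representation[symmetric]) simp
  qed
  ultimately show thesis using that by blast
qed

lemma locally_integrable_borel_measurable:
  assumes "locally_integrable (f :: real^'n::finite \<Rightarrow> 'b::euclidean_space)"
  shows "f \<in> borel_measurable lebesgue"
proof (rule borel_measurable_LIMSEQ_metric)
  show "(\<lambda>x. indicat_real (cball 0 (real n)) x *\<^sub>R f x) \<in> borel_measurable lebesgue" for n
    using assms unfolding locally_integrable_def set_integrable_def
    by (metis borel_measurable_integrable compact_cball)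
  fix x :: "real^'n"
  obtain n0 :: nat where n0: "norm x \<le> real n0" using real_arch_simple by blast
  have "eventually (\<lambda>n. f x = indicat_real (cball 0 (real n)) x *\<^sub>R f x) sequentially"
    using n0 by (intro eventually_sequentiallyI[of n0]) (auto intro: order_trans)
  then show "(\<lambda>n. indicat_real (cball 0 (real n)) x *\<^sub>R f x) \<longlonglongrightarrow> f x"
    by (rule Lim_transform_eventually[OF tendsto_const])
qed

text \<open>
  The mollification argument uses Tonelli on the product of Borel measures, so a Lebesgue measurable function is
  first replaced by a Borel function that agrees with it almost everywhere.
\<close>

lemma mollification_of_locally_integrable:
  assumes loc: "locally_integrable (f :: real^'n::finite \<Rightarrow> 'b::euclidean_space)"
    and f': "f' \<in> borel_measurable borel" "AE x in lborel. f x = f' x"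
  shows "mollification f'"
proof
  show "f' \<in> borel_measurable borel" by fact
  fix r :: real
  have m0: "(\<lambda>x. indicat_real (cball 0 r) x *\<^sub>R f' x) \<in> borel_measurable borel"
    by (rule borel_measurable_scaleR[OF borel_measurable_indicator f'(1)]) simp
  have m': "(\<lambda>x. indicat_real (cball 0 r) x *\<^sub>R f' x) \<in> borel_measurable lebesgue"
    using m0 by (intro measurable_completion) simp
  have "integrable lebesgue (\<lambda>x. indicat_real (cball 0 r) x *\<^sub>R f x)"
    using loc unfolding locally_integrable_def set_integrable_def by simp
  then have "integrable lebesgue (\<lambda>x. indicat_real (cball 0 r) x *\<^sub>R f' x)"
    by (rule integrable_cong_AE_imp) (use m' f'(2) in \<open>auto simp: AE_completion_iff\<close>)
  then show "set_integrable lborel (cball 0 r) f'"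
    unfolding set_integrable_def using m0 by (subst (asm) integrable_completion) simp_all
qed

theorem theorem2:
  fixes p :: real
    and u :: "real^'n::finite \<Rightarrow> 'b::{real_normed_field,euclidean_space}"
    and grad_u :: "real^'n \<Rightarrow> 'b^'n"
  assumes "p \<ge> 2"
    and "CARD('n) \<ge> 2"
    and "u \<in> sobolev_W1A p"
    and "u has_weak_gradient grad_u"
  shows "(\<integral>\<^sup>+ x. ennreal (norm (grad_u x) powr p) \<partial>lebesgue)
           \<ge> ennreal (C_H CARD('n) p) *
             (\<integral>\<^sup>+ x. ennreal (norm (u x) powr p / norm x powr p) \<partial>lebesgue)"
proof -
  have Lp: "u \<in> Lp_space p" and anti: "antisymmetric u"
    using assms(3) by (auto simp: sobolev_W1A_def sobolev_W1_def)
  have loc: "locally_integrable u" "locally_integrable grad_u"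
    and weak: "\<And>\<phi> i. \<phi> \<in> test_functions \<Longrightarrow>
      (LINT x|lebesgue. partial i \<phi> x *\<^sub>R u x) = - (LINT x|lebesgue. \<phi> x *\<^sub>R (grad_u x $ i))"
    using assms(4) by (auto simp: has_weak_gradient_def)
  have mu: "u \<in> borel_measurable lebesgue" and mg: "grad_u \<in> borel_measurable lebesgue"
    using loc by (auto intro: locally_integrable_borel_measurable)
  obtain v where v: "v \<in> borel_measurable borel" "AE x in lborel. u x = v x"
    using lebesgue_ex_borel_version[OF mu] .
  obtain g where g: "g \<in> borel_measurable borel" "AE x in lborel. grad_u x = g x"
    using lebesgue_ex_borel_version[OF mg] .
  have vL: "v \<in> borel_measurable lebesgue" and gL: "g \<in> borel_measurable lebesgue"
    using v(1) g(1) by (simp_all add: measurable_completion)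
  have weak': "(LINT y|lborel. partial i \<phi> y *\<^sub>R v y) = - (LINT y|lborel. \<phi> y *\<^sub>R (g y $ i))"
    if \<phi>: "\<phi> \<in> test_functions" for \<phi> i
  proof -
    have b: "\<phi> \<in> borel_measurable borel" "partial i \<phi> \<in> borel_measurable borel"
      using test_function_partials(1,2)[OF \<phi>] by (auto intro: borel_measurable_continuous_onI)
    have nth: "(\<lambda>z::'b^'n. z $ i) \<in> borel_measurable borel"
      by (intro borel_measurable_continuous_onI continuous_intros)
    have gi: "(\<lambda>y. g y $ i) \<in> borel_measurable borel"
      using measurable_comp[OF g(1) nth] by (simp add: o_def)
    have gui: "(\<lambda>y. grad_u y $ i) \<in> borel_measurable lebesgue"
      using measurable_comp[OF mg nth] by (simp add: o_def)
    have bL: "\<phi> \<in> borel_measurable lebesgue" "partial i \<phi> \<in> borel_measurable lebesgue" "(\<lambda>y. g y $ i) \<in> borel_measurable lebesgue"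
      using b gi by (simp_all add: measurable_completion)
    have "(LINT y|lebesgue. partial i \<phi> y *\<^sub>R u y) = (LINT y|lebesgue. partial i \<phi> y *\<^sub>R v y)"
      by (rule integral_cong_AE) (use bL mu vL v(2) in \<open>auto simp: AE_completion_iff\<close>)
    also have "\<dots> = (LINT y|lborel. partial i \<phi> y *\<^sub>R v y)"
      using b v(1) by (intro integral_completion) simp
    finally have 1: "(LINT y|lebesgue. partial i \<phi> y *\<^sub>R u y) = (LINT y|lborel. partial i \<phi> y *\<^sub>R v y)" .
    have "(LINT y|lebesgue. \<phi> y *\<^sub>R (grad_u y $ i)) = (LINT y|lebesgue. \<phi> y *\<^sub>R (g y $ i))"
      by (rule integral_cong_AE) (use bL gui g(2) in \<open>auto simp: AE_completion_iff\<close>)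
    also have "\<dots> = (LINT y|lborel. \<phi> y *\<^sub>R (g y $ i))"
      using b gi by (intro integral_completion) simp
    finally show ?thesis using weak[OF \<phi>, of i] 1 by simp
  qed
  have anti': "AE y in lborel. v (swap_coords i j y) = - v y" if "i \<noteq> j" for i j
  proof -
    have "AE y in lborel. u (swap_coords i j y) = - u y"
      using anti that by (simp add: antisymmetric_def AE_completion_iff)
    moreover have "AE y in lborel. u (swap_coords i j y) = v (swap_coords i j y)"
    proof -
      have "AE y in distr lborel borel (swap_coords i j). u y = v y"
        by (subst lborel_distr_swap_coords) (rule v(2))
      then show ?thesis by (rule AE_distrD[rotated]) simp
    qed
    ultimately show ?thesis using v(2) by eventually_elim simp
  qed
  have vp: "(\<integral>\<^sup>+x. ennreal (norm (u x) powr p) \<partial>lborel) = (\<integral>\<^sup>+x. ennreal (norm (v x) powr p) \<partial>lborel)"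
    by (rule nn_integral_cong_AE) (use v(2) in auto)
  have "(\<integral>\<^sup>+x. ennreal (norm (u x) powr p) \<partial>lborel) < \<infinity>"
    using Lp by (simp add: Lp_space_def integrable_iff_bounded nn_integral_completion)
  then have fin: "(\<integral>\<^sup>+x. ennreal (norm (v x) powr p) \<partial>lborel) < \<infinity>" by (simp add: vp)
  have "ennreal (C_H CARD('n) p) * (\<integral>\<^sup>+x. ennreal (norm (v x) powr p / norm x powr p) \<partial>lborel)
     \<le> (\<integral>\<^sup>+x. ennreal (norm (g x) powr p) \<partial>lborel)"
    by (rule hardy_weak_gradient[OF assms(1,2) mollification_of_locally_integrable[OF loc(1) v]
          mollification_of_locally_integrable[OF loc(2) g] weak' anti' fin])
  also have "(\<integral>\<^sup>+x. ennreal (norm (v x) powr p / norm x powr p) \<partial>lborel)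
     = (\<integral>\<^sup>+x. ennreal (norm (u x) powr p / norm x powr p) \<partial>lebesgue)"
    unfolding nn_integral_completion by (rule nn_integral_cong_AE) (use v(2) in auto)
  also have "(\<integral>\<^sup>+x. ennreal (norm (g x) powr p) \<partial>lborel) = (\<integral>\<^sup>+x. ennreal (norm (grad_u x) powr p) \<partial>lebesgue)"
    unfolding nn_integral_completion by (rule nn_integral_cong_AE) (use g(2) in auto)
  finally show ?thesis .
qed

end
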